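(* Let $k$ be a field and let $$R=\left\{\begin{pmatrix} f(x)& g(x)\\ 0& f(x^2)\end{pmatrix} : f,g\in k[[x]]\right\}+y\,M_2(k[[x,y]])\;\subset\; M_2(k[[x,y]]).$$ Then $R$ is a prime noetherian complete local PI algebra over $k$. Moreover, $R$ has no weak adic filtration $\Gamma$ such that the associated graded ring $\operatorname{gr}_\Gamma R$ is right noetherian. In particular, the Jacobson radical $J(R)$ does not satisfy the strong AR property.
   Context: PI means satisfying a polynomial identity; noetherian means left and right noetherian; complete means complete (and separated) with respect to the $J(R)$-adic topology. A filtration of a $k$-algebra $R$ means an ascending chain of $k$-subspaces $\Gamma=\{\Gamma_i\subseteq\Gamma_{i+1} : i\in\mathbb{Z}\}$ of $R$ such that: (1) $1\in\Gamma_0$ and $\Gamma_i\Gamma_j\subseteq\Gamma_{i+j}$ for all $i,j\in\mathbb{Z}$; (2) $\Gamma$ is finite: $\dim_k\Gamma_i/\Gamma_{i-1}<\infty$ for all $i\in\mathbb{Z}$; (3) $\Gamma$ is exhaustive and separated: $R=\bigcup_{i\in\mathbb{Z}}\Gamma_i$ and $\bigcap_{i\in\mathbb{Z}}\Gamma_i=0$. The associated graded ring is $\operatorname{gr}_\Gamma R=\bigoplus_{i\in\mathbb{Z}}\Gamma_i/\Gamma_{i-1}$. For a semilocal algebra $R$ with Jacobson radical $\mathfrak{m}=J(R)$ and $\dim_k R/\mathfrak{m}<\infty$, a filtration $\Gamma$ of $R$ is a weak adic filtration if $\Gamma_n=R$ for all $n\ge 0$ and $\Gamma_{-1}\subseteq\mathfrak{m}$.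 An ideal $I$ of a ring $R$ satisfies the strong AR property if the Rees ring $\operatorname{Rees}_I R=\bigoplus_{j\ge 0}I^j$ (graded, with multiplication $I^i\times I^j\to I^{i+j}$ and $I^0=R$) is noetherian. *)

theory Defs
  imports
    "HOL-Analysis.Analysis"
    "HOL-Computational_Algebra.Formal_Power_Series"
    "HOL-Algebra.Algebra"
    "HOL-Algebra.Algebraic_Closure_Type"
begin

section \<open>Noncommutative rings\<close>

definition right_ideal :: "'r set \<Rightarrow> ('r, 'm) ring_scheme \<Rightarrow> bool" where
  "right_ideal I R \<longleftrightarrow> additive_subgroup I R \<and>
     (\<forall>a\<in>I. \<forall>x\<in>carrier R. a \<otimes>\<^bsub>R\<^esub> x \<in> I)"

definition left_ideal :: "'r set \<Rightarrow> ('r, 'm) ring_scheme \<Rightarrow> bool" where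
  "left_ideal I R \<longleftrightarrow> additive_subgroup I R \<and>
     (\<forall>a\<in>I. \<forall>x\<in>carrier R. x \<otimes>\<^bsub>R\<^esub> a \<in> I)"

definition right_noetherian :: "('r, 'm) ring_scheme \<Rightarrow> bool" where
  "right_noetherian R \<longleftrightarrow> (\<forall>I. right_ideal I R \<longrightarrow>
     (\<exists>A\<subseteq>carrier R. finite A \<and> I = \<Inter>{J. right_ideal J R \<and> A \<subseteq> J}))"

definition left_noetherian :: "('r, 'm) ring_scheme \<Rightarrow> bool" where
  "left_noetherian R \<longleftrightarrow> (\<forall>I. left_ideal I R \<longrightarrow>
     (\<exists>A\<subseteq>carrier R. finite A \<and> I = \<Inter>{J. left_ideal J R \<and> A \<subseteq> J}))"

definition noetherian :: "('r, 'm) ring_scheme \<Rightarrow> bool" where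
  "noetherian R \<longleftrightarrow> left_noetherian R \<and> right_noetherian R"

definition prime_ring :: "('r, 'm) ring_scheme \<Rightarrow> bool" where
  "prime_ring R \<longleftrightarrow> carrier R \<noteq> {\<zero>\<^bsub>R\<^esub>} \<and>
     (\<forall>I J. ideal I R \<and> ideal J R \<and> I \<cdot>\<^bsub>R\<^esub> J = {\<zero>\<^bsub>R\<^esub>} \<longrightarrow> I = {\<zero>\<^bsub>R\<^esub>} \<or> J = {\<zero>\<^bsub>R\<^esub>})"

definition maximal_right_ideal :: "'r set \<Rightarrow> ('r, 'm) ring_scheme \<Rightarrow> bool" where
  "maximal_right_ideal I R \<longleftrightarrow> right_ideal I R \<and> I \<noteq> carrier R \<and>
     (\<forall>J. right_ideal J R \<and> I \<subseteq> J \<longrightarrow> J = I \<or> J = carrier R)"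

definition jacobson_radical :: "('r, 'm) ring_scheme \<Rightarrow> 'r set" where
  "jacobson_radical R = {x \<in> carrier R. \<forall>I. maximal_right_ideal I R \<longrightarrow> x \<in> I}"

definition division_ring :: "('r, 'm) ring_scheme \<Rightarrow> bool" where
  "division_ring R \<longleftrightarrow> ring R \<and> \<one>\<^bsub>R\<^esub> \<noteq> \<zero>\<^bsub>R\<^esub> \<and> Units R = carrier R - {\<zero>\<^bsub>R\<^esub>}"

definition local_ring :: "('r, 'm) ring_scheme \<Rightarrow> bool" where
  "local_ring R \<longleftrightarrow> division_ring (R Quot (jacobson_radical R))"

primrec ideal_power :: "('r, 'm) ring_scheme \<Rightarrow> 'r set \<Rightarrow> nat \<Rightarrow> 'r set" where
  "ideal_power R I 0 = carrier R"
| "ideal_power R I (Suc n) = ideal_power R I n \<cdot>\<^bsub>R\<^esub> I"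

text \<open>The \<open>I\<close>-adic topology is first countable, so sequences suffice to test completeness.\<close>

definition adically_complete :: "('r, 'm) ring_scheme \<Rightarrow> 'r set \<Rightarrow> bool" where
  "adically_complete R I \<longleftrightarrow>
     (\<Inter>n. ideal_power R I n) = {\<zero>\<^bsub>R\<^esub>} \<and>
     (\<forall>s :: nat \<Rightarrow> 'r. (\<forall>n. s n \<in> carrier R) \<and>
        (\<forall>N. \<exists>n0. \<forall>m\<ge>n0. \<forall>n\<ge>n0. s m \<ominus>\<^bsub>R\<^esub> s n \<in> ideal_power R I N) \<longrightarrow>
        (\<exists>l\<in>carrier R. \<forall>N. \<exists>n0. \<forall>n\<ge>n0. s n \<ominus>\<^bsub>R\<^esub> l \<in> ideal_power R I N))"

definition complete_ring :: "('r, 'm) ring_scheme \<Rightarrow> bool" where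
  "complete_ring R \<longleftrightarrow> adically_complete R (jacobson_radical R)"

text \<open>The Rees ring is \<open>\<Oplus>\<^sub>j I\<^sup>j t\<^sup>j\<close> inside the polynomial ring \<open>R[t]\<close>; the library construction
  \<^const>\<open>UP\<close> does not need \<open>R\<close> to be commutative.\<close>

definition rees_ring :: "('r, 'm) ring_scheme \<Rightarrow> 'r set \<Rightarrow> ('r, nat \<Rightarrow> 'r) up_ring" where
  "rees_ring R I = (UP R)\<lparr>carrier := {p \<in> carrier (UP R). \<forall>j. p j \<in> ideal_power R I j}\<rparr>"

definition strong_AR :: "('r, 'm) ring_scheme \<Rightarrow> 'r set \<Rightarrow> bool" where
  "strong_AR R I \<longleftrightarrow> noetherian (rees_ring R I)"


section \<open>Algebras over a field\<close>

text \<open>The library locale \<^locale>\<open>algebra\<close> is restricted to commutative algebras.\<close>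

definition k_algebra :: "('k, 'n) ring_scheme \<Rightarrow> ('k, 'r, 'm) module_scheme \<Rightarrow> bool" where
  "k_algebra K R \<longleftrightarrow> field K \<and> ring R \<and> Module.module K R \<and>
     (\<forall>c\<in>carrier K. \<forall>x\<in>carrier R. \<forall>y\<in>carrier R.
        (c \<odot>\<^bsub>R\<^esub> x) \<otimes>\<^bsub>R\<^esub> y = c \<odot>\<^bsub>R\<^esub> (x \<otimes>\<^bsub>R\<^esub> y) \<and>
        x \<otimes>\<^bsub>R\<^esub> (c \<odot>\<^bsub>R\<^esub> y) = c \<odot>\<^bsub>R\<^esub> (x \<otimes>\<^bsub>R\<^esub> y))"

text \<open>An element \<open>p\<close> of the free algebra \<open>K\<langle>X\<^sub>0, X\<^sub>1, \<dots>\<rangle>\<close> is given by its finitely many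
  nonzero coefficients, indexed by words in the variables.\<close>

definition nc_eval ::
  "('k, 'n) ring_scheme \<Rightarrow> ('k, 'r, 'm) module_scheme \<Rightarrow> (nat list \<Rightarrow> 'k) \<Rightarrow> (nat \<Rightarrow> 'r) \<Rightarrow> 'r" where
  "nc_eval K R p a = (\<Oplus>\<^bsub>R\<^esub>w \<in> {w. p w \<noteq> \<zero>\<^bsub>K\<^esub>}.
     p w \<odot>\<^bsub>R\<^esub> foldr (\<lambda>i x. a i \<otimes>\<^bsub>R\<^esub> x) w \<one>\<^bsub>R\<^esub>)"

definition PI_algebra :: "('k, 'n) ring_scheme \<Rightarrow> ('k, 'r, 'm) module_scheme \<Rightarrow> bool" where
  "PI_algebra K R \<longleftrightarrow> k_algebra K R \<and>
     (\<exists>p :: nat list \<Rightarrow> 'k. (\<forall>w. p w \<in> carrier K) \<and> finite {w. p w \<noteq> \<zero>\<^bsub>K\<^esub>} \<and>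
        (\<exists>w. p w \<noteq> \<zero>\<^bsub>K\<^esub>) \<and>
        (\<forall>a \<in> UNIV \<rightarrow> carrier R. nc_eval K R p a = \<zero>\<^bsub>R\<^esub>))"


section \<open>Filtrations\<close>

text \<open>\<open>dim\<^sub>K V/W < \<infinity>\<close>: the cosets of finitely many elements of \<open>V\<close> span \<open>V/W\<close>.\<close>

definition finite_dim_quotient ::
  "('k, 'n) ring_scheme \<Rightarrow> ('k, 'r, 'm) module_scheme \<Rightarrow> 'r set \<Rightarrow> 'r set \<Rightarrow> bool" where
  "finite_dim_quotient K R V W \<longleftrightarrow> (\<exists>B\<subseteq>V. finite B \<and>
     (\<forall>v\<in>V. \<exists>c \<in> B \<rightarrow> carrier K. v \<in> W +>\<^bsub>R\<^esub> (\<Oplus>\<^bsub>R\<^esub>b\<in>B. c b \<odot>\<^bsub>R\<^esub> b)))"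

definition filtration ::
  "('k, 'n) ring_scheme \<Rightarrow> ('k, 'r, 'm) module_scheme \<Rightarrow> (int \<Rightarrow> 'r set) \<Rightarrow> bool" where
  "filtration K R \<Gamma> \<longleftrightarrow>
     (\<forall>i. submodule (\<Gamma> i) K R) \<and>
     (\<forall>i. \<Gamma> i \<subseteq> \<Gamma> (i + 1)) \<and>
     \<one>\<^bsub>R\<^esub> \<in> \<Gamma> 0 \<and>
     (\<forall>i j. \<forall>x\<in>\<Gamma> i. \<forall>y\<in>\<Gamma> j. x \<otimes>\<^bsub>R\<^esub> y \<in> \<Gamma> (i + j)) \<and>
     (\<forall>i. finite_dim_quotient K R (\<Gamma> i) (\<Gamma> (i - 1))) \<and>
     (\<Union>i. \<Gamma> i) = carrier R \<and>
     (\<Inter>i. \<Gamma> i) = {\<zero>\<^bsub>R\<^esub>}"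

text \<open>The standing hypotheses that \<open>R\<close> is semilocal with \<open>dim\<^sub>K R/J(R) < \<infinity>\<close> are deliberately not part
  of this predicate, so that its negation cannot hold through their failure.\<close>

definition weak_adic_filtration ::
  "('k, 'n) ring_scheme \<Rightarrow> ('k, 'r, 'm) module_scheme \<Rightarrow> (int \<Rightarrow> 'r set) \<Rightarrow> bool" where
  "weak_adic_filtration K R \<Gamma> \<longleftrightarrow> filtration K R \<Gamma> \<and>
     (\<forall>n\<ge>0. \<Gamma> n = carrier R) \<and> \<Gamma> (- 1) \<subseteq> jacobson_radical R"

text \<open>Elements of the associated graded ring are finitely supported families of cosets; the
  \<open>n\<close>-th component of a product is a finite sum in \<open>\<Gamma>\<^sub>n/\<Gamma>\<^sub>n\<^sub>-\<^sub>1\<close> (taken in the ambient group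
  \<open>R/\<Gamma>\<^sub>n\<^sub>-\<^sub>1\<close>) of the products \<open>(a + \<Gamma>\<^sub>i\<^sub>-\<^sub>1)(b + \<Gamma>\<^sub>j\<^sub>-\<^sub>1) = ab + \<Gamma>\<^sub>n\<^sub>-\<^sub>1\<close> with \<open>i + j = n\<close>.\<close>

definition assoc_graded ::
  "('r, 'm) ring_scheme \<Rightarrow> (int \<Rightarrow> 'r set) \<Rightarrow> (int \<Rightarrow> 'r set) ring" where
  "assoc_graded R \<Gamma> = \<lparr>
     carrier = {f. (\<forall>i. f i \<in> (\<lambda>a. \<Gamma> (i - 1) +>\<^bsub>R\<^esub> a) ` \<Gamma> i) \<and> finite {i. f i \<noteq> \<Gamma> (i - 1)}},
     mult = (\<lambda>f g n. finprod (R A_Mod \<Gamma> (n - 1))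
       (\<lambda>i. rcoset_mult R (\<Gamma> (n - 1)) (f i) (g (n - i))) {i. f i \<noteq> \<Gamma> (i - 1)}),
     one = (\<lambda>i. if i = 0 then \<Gamma> (- 1) +>\<^bsub>R\<^esub> \<one>\<^bsub>R\<^esub> else \<Gamma> (i - 1)),
     ring.zero = (\<lambda>i. \<Gamma> (i - 1)),
     add = (\<lambda>f g i. f i <+>\<^bsub>R\<^esub> g i)\<rparr>"


section \<open>The ring of the counterexample\<close>

text \<open>The power series ring \<open>k[[x,y]]\<close> is \<open>k[[x]][[y]]\<close>, with \<open>x\<close> the inner variable
  \<open>fps_const fps_X\<close> and \<open>y\<close> the outer variable \<open>fps_X\<close>. Matrix multiplication is
  \<open>**\<close>; the operation \<open>*\<close> on vectors is componentwise.\<close>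

definition matrix_algebra :: "('k::field, 'k fps fps ^ 2 ^ 2) module" where
  "matrix_algebra = \<lparr>carrier = UNIV, mult = (**), one = mat 1, ring.zero = 0, add = (+),
     smult = (\<lambda>c A. \<chi> i j. fps_const (fps_const c) * A $ i $ j)\<rparr>"

definition example_ring :: "('k::field, 'k fps fps ^ 2 ^ 2) module" where
  "example_ring = matrix_algebra\<lparr>carrier :=
     {vector [vector [fps_const f, fps_const g],
              vector [0,           fps_const (f oo fps_X ^ 2)]] + (\<chi> i j. fps_X * B $ i $ j)
      | (f :: 'k fps) (g :: 'k fps) (B :: 'k fps fps ^ 2 ^ 2). True}\<rparr>"

end

theory Submission
  imports Defs
begin

text \<open>
  Write \<open>S = k[[x,y]]\<close>. A matrix of the example ring is determined modulo \<open>y M\<^sub>2(S)\<close> by two power series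
  \<open>f\<close> and \<open>g\<close> in \<open>k[[x]]\<close>, and the product of the matrices of \<open>(f, g)\<close> and \<open>(f', g')\<close> belongs to
  \<open>(f f', f g' + g f'(x\<^sup>2))\<close>.

  The matrices \<open>tau h = diag(h(x,y), h(x\<^sup>2,y))\<close> form
  a copy of \<open>S\<close> inside the ring over which \<open>M\<^sub>2(S)\<close> is finitely generated on both sides, so the ring
  inherits noetherianity from \<open>S\<close> (\<open>fg_submodules_fps\<close>, \<open>fg_submodules_of_fg\<close>). A matrix with
  \<open>f(0) \<noteq> 0\<close> is a unit (\<open>example_ring_unit\<close>), so the ring is local with maximal ideal \<open>f(0) = 0\<close>, and
  the powers of this ideal define the topology of coefficientwise convergence
  (\<open>ideal_power_subset_W\<close>, \<open>W_subset_ideal_power\<close>), for which the ring is closed in \<open>M\<^sub>2(S)\<close>.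
  Primeness holds because the ring contains \<open>y M\<^sub>2(S)\<close>, and the polynomial identity is Hall's identity
  for \<open>2 \<times> 2\<close> matrices.

  The negative statements rest on an asymmetry of the ideal \<open>f = 0\<close>: right multiplication by an element
  whose \<open>f\<close> has order \<open>q\<close> raises the order of \<open>g\<close> by \<open>2 q\<close> (\<open>res_mult_growth\<close>), whereas multiplying
  that element by \<open>E\<^sub>1\<^sub>2\<close> on the right produces an element of the ideal whose \<open>g\<close> has order only \<open>q\<close>.
  Let \<open>\<Gamma>\<close> be a weak adic filtration whose graded ring is right noetherian. Then the symbols of
  the ideal are generated on the right by finitely many of them, and the order of \<open>g\<close> on the ideal has to
  grow along the filtration about twice as fast as the order of \<open>f\<close> (\<open>right_noetherian_growth\<close>), while
  \<open>E\<^sub>1\<^sub>2\<close> shows that it grows at most as fast (\<open>ord_g_le_ord_f\<close>). This is contradictory once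
  both orders are known to be unbounded, which is Chevalley's theorem (\<open>\<Gamma>_subset_W\<close>): a decreasing
  sequence of open ideals with zero intersection is cofinal with the powers of the maximal ideal. The
  steps of \<open>\<Gamma>\<close> are open because they have finite codimension. The same comparison of orders in the
  Rees ring of the maximal ideal, where the least order of \<open>f\<close> in degree \<open>n\<close> is \<open>n\<close>, refutes
  the strong AR property.
\<close>

section \<open>Noetherian commutative rings and power series\<close>

text \<open>For the action of a commutative ring on itself this says that the ring is noetherian.\<close>

definition fg_submodules :: "('a::comm_ring_1 \<Rightarrow> 'b::ab_group_add \<Rightarrow> 'b) \<Rightarrow> bool" where
  "fg_submodules scl \<longleftrightarrow>
     (\<forall>N. Modules.module.subspace scl N \<longrightarrow> (\<exists>B. finite B \<and> B \<subseteq> N \<and> N \<subseteq> Modules.module.span scl B))"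

lemma module_times: "Modules.module ((*) :: 'a::comm_ring_1 \<Rightarrow> 'a \<Rightarrow> 'a)"
  by unfold_locales (simp_all add: algebra_simps)

abbreviation is_ideal :: "'a::comm_ring_1 set \<Rightarrow> bool" where
  "is_ideal \<equiv> Modules.module.subspace (*)"

abbreviation ideal_span :: "'a::comm_ring_1 set \<Rightarrow> 'a set" where
  "ideal_span \<equiv> Modules.module.span (*)"

text \<open>The only ideals are \<open>0\<close> and the whole field.\<close>

lemma fg_submodules_field: "fg_submodules ((*) :: 'k::field \<Rightarrow> 'k \<Rightarrow> 'k)"
  unfolding fg_submodules_def
proof (intro allI impI)
  fix N :: "'k set" assume N: "is_ideal N"
  show "\<exists>B. finite B \<and> B \<subseteq> N \<and> N \<subseteq> ideal_span B"
  proof (cases "N \<subseteq> {0}")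
    case True
    then show ?thesis by (intro exI[of _ "{}"]) auto
  next
    case False
    then obtain x where x: "x \<in> N" "x \<noteq> 0" by auto
    have "y \<in> ideal_span {x}" for y
      using Modules.module.span_scale[OF module_times Modules.module.span_base[OF module_times, of x "{x}"], of "y / x"] x
      by simp
    then show ?thesis using x by (intro exI[of _ "{x}"]) auto
  qed
qed

text \<open>Induction on the number of generators: modulo the span of the other generators, a submodule
  is determined by the ideal of coefficients of the new generator.\<close>

lemma fg_submodules_of_fg:
  fixes scl :: "'a::comm_ring_1 \<Rightarrow> 'b::ab_group_add \<Rightarrow> 'b"
  assumes "Modules.module scl" and noeth: "fg_submodules ((*) :: 'a \<Rightarrow> 'a \<Rightarrow> 'a)"
    and fin: "finite B0" and sp: "Modules.module.span scl B0 = UNIV"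
  shows "fg_submodules scl"
proof -
  interpret Modules.module scl by fact
  interpret R: Modules.module "(*) :: 'a \<Rightarrow> 'a \<Rightarrow> 'a" by (rule module_times)
  have main: "\<forall>N. subspace N \<and> N \<subseteq> span S \<longrightarrow> (\<exists>B. finite B \<and> B \<subseteq> N \<and> N \<subseteq> span B)"
    if "finite S" for S
    using that
  proof (induction S rule: finite_induct)
    case empty
    show ?case
    proof (intro allI impI)
      fix N assume "subspace N \<and> N \<subseteq> span {}"
      then show "\<exists>B. finite B \<and> B \<subseteq> N \<and> N \<subseteq> span B"
        by (intro exI[of _ "{}"]) auto
    qed
  next
    case (insert b S)
    show ?case
    proof (intro allI impI)
      fix N assume N: "subspace N \<and> N \<subseteq> span (insert b S)"
      define I where "I = {r. \<exists>n\<in>N. n - scl r b \<in> span S}"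
      have "is_ideal I"
        unfolding R.subspace_def I_def
      proof (intro conjI ballI allI)
        show "0 \<in> {r. \<exists>n\<in>N. n - scl r b \<in> span S}"
          using N subspace_0[of N] by (auto intro!: bexI[of _ 0] span_zero)
      next
        fix r s assume "r \<in> {r. \<exists>n\<in>N. n - scl r b \<in> span S}" "s \<in> {r. \<exists>n\<in>N. n - scl r b \<in> span S}"
        then obtain m n where *: "m \<in> N" "n \<in> N" "m - scl r b \<in> span S" "n - scl s b \<in> span S" by auto
        have "m + n - scl (r + s) b = (m - scl r b) + (n - scl s b)"
          by (simp add: scale_left_distrib)
        then have "m + n - scl (r + s) b \<in> span S" using span_add[OF *(3,4)] by metis
        then show "r + s \<in> {r. \<exists>n\<in>N. n - scl r b \<in> span S}"
          using * N by (auto intro!: bexI[of _ "m + n"] subspace_add)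
      next
        fix c r assume "r \<in> {r. \<exists>n\<in>N. n - scl r b \<in> span S}"
        then obtain m where *: "m \<in> N" "m - scl r b \<in> span S" by auto
        have "scl c m - scl (c * r) b = scl c (m - scl r b)"
          by (simp add: scale_right_diff_distrib)
        then have "scl c m - scl (c * r) b \<in> span S" using span_scale[OF *(2)] by metis
        then show "c * r \<in> {r. \<exists>n\<in>N. n - scl r b \<in> span S}"
          using * N by (auto intro!: bexI[of _ "scl c m"] subspace_scale)
      qed
      then obtain C where C: "finite C" "C \<subseteq> I" "I \<subseteq> ideal_span C"
        using noeth unfolding fg_submodules_def by blast
      from C(2) have "\<forall>c\<in>C. \<exists>n. n \<in> N \<and> n - scl c b \<in> span S" by (auto simp: I_def)
      then obtain l where l: "\<And>c. c \<in> C \<Longrightarrow> l c \<in> N \<and> l c - scl c b \<in> span S" by metis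
      have "subspace (N \<inter> span S)" using N by (auto intro: subspace_inter subspace_span)
      then obtain B where B: "finite B" "B \<subseteq> N \<inter> span S" "N \<inter> span S \<subseteq> span B"
        using insert.IH by (meson Int_lower2)
      have "n \<in> span (l ` C \<union> B)" if n: "n \<in> N" for n
      proof -
        obtain r where r: "n - scl r b \<in> span S"
          using n N span_breakdown_eq by blast
        then have "r \<in> ideal_span C" using n C(3) by (auto simp: I_def)
        then obtain u where u: "r = (\<Sum>c\<in>C. u c * c)"
          using R.span_finite[OF C(1)] by auto
        define m where "m = (\<Sum>c\<in>C. scl (u c) (l c))"
        have mN: "m \<in> N" unfolding m_def using l N by (auto intro!: subspace_sum subspace_scale)
        have "m - scl r b = (\<Sum>c\<in>C. scl (u c) (l c - scl c b))"
          unfolding m_def u by (simp add: scale_right_diff_distrib sum_subtractf scale_sum_left)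
        also have "\<dots> \<in> span S" using l by (auto intro!: span_sum span_scale)
        finally have "n - m \<in> span S" using span_diff[OF r] by fastforce
        then have "n - m \<in> N \<inter> span S" using n mN N by (auto intro: subspace_diff)
        then have "n - m \<in> span (l ` C \<union> B)" using B(3) span_mono[of B "l ` C \<union> B"] by blast
        moreover have "m \<in> span (l ` C \<union> B)"
          unfolding m_def by (intro span_sum span_scale span_base) auto
        ultimately show ?thesis using span_add by fastforce
      qed
      then show "\<exists>B. finite B \<and> B \<subseteq> N \<and> N \<subseteq> span B"
        using C(1) B l by (intro exI[of _ "l ` C \<union> B"]) auto
    qed
  qed
  show ?thesis unfolding fg_submodules_def using main[OF fin] sp by auto
qed

text \<open>Hilbert's basis theorem for power series. The ideals \<open>L m\<close> of leading coefficients at order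
  \<open>m\<close> increase with \<open>m\<close> and stabilise at some \<open>m0\<close>. Lifts of generators of \<open>L 0, \<dots>, L m0\<close>
  generate: at orders below \<open>m0\<close> the lifts for that order raise the order by one, and from \<open>m0\<close> on
  the multiples \<open>X\<^sup>t g\<close> of the lifts for \<open>m0\<close> suffice, the coefficients collected over all \<open>t\<close>
  forming power series.\<close>

lemma fg_submodules_fps:
  assumes noeth: "fg_submodules ((*) :: 'a::comm_ring_1 \<Rightarrow> 'a \<Rightarrow> 'a)"
  shows "fg_submodules ((*) :: 'a fps \<Rightarrow> 'a fps \<Rightarrow> 'a fps)"
  unfolding fg_submodules_def
proof (intro allI impI)
  interpret R: Modules.module "(*) :: 'a \<Rightarrow> 'a \<Rightarrow> 'a" by (rule module_times)
  interpret M: Modules.module "(*) :: 'a fps \<Rightarrow> 'a fps \<Rightarrow> 'a fps" by (rule module_times)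
  fix N :: "'a fps set" assume N: "is_ideal N"
  define Od where "Od m = {f \<in> N. \<forall>j<m. fps_nth f j = 0}" for m
  define L where "L m = (\<lambda>f. fps_nth f m) ` Od m" for m
  have Osub: "is_ideal (Od m)" for m
    unfolding M.subspace_def Od_def using N
    by (auto simp: M.subspace_0 M.subspace_add M.subspace_scale fps_mult_nth)
  have lead: "fps_nth (c * f) m = fps_nth c 0 * fps_nth f m" if "f \<in> Od m" for c f m
  proof -
    have "fps_nth (c * f) m = (\<Sum>i\<in>{0..m}. fps_nth c i * fps_nth f (m - i))" by (simp add: fps_mult_nth)
    also have "\<dots> = (\<Sum>i\<in>{0}. fps_nth c i * fps_nth f (m - i))"
      using that by (intro sum.mono_neutral_right) (auto simp: Od_def)
    finally show ?thesis by simp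
  qed
  have Lsub: "is_ideal (L m)" for m
    unfolding R.subspace_def
  proof (intro conjI ballI allI)
    show "0 \<in> L m" unfolding L_def using M.subspace_0[OF Osub] by (auto intro!: image_eqI[of _ _ 0])
  next
    fix x y assume "x \<in> L m" "y \<in> L m"
    then show "x + y \<in> L m" unfolding L_def using M.subspace_add[OF Osub]
      by (auto simp flip: fps_add_nth)
  next
    fix c x assume "x \<in> L m"
    then obtain f where f: "f \<in> Od m" "x = fps_nth f m" by (auto simp: L_def)
    then have "c * x = fps_nth (fps_const c * f) m" using lead by simp
    then show "c * x \<in> L m" unfolding L_def using f M.subspace_scale[OF Osub] by blast
  qed
  have shiftO: "fps_X ^ t * f \<in> Od (m + t)" if "f \<in> Od m" for f m t
    using that N by (auto simp: Od_def fps_X_power_mult_nth M.subspace_scale)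
  have Lmono: "L m \<subseteq> L n" if "m \<le> n" for m n
  proof
    fix x assume "x \<in> L m"
    then obtain f where f: "f \<in> Od m" "x = fps_nth f m" by (auto simp: L_def)
    then have "x = fps_nth (fps_X ^ (n - m) * f) n" using that by (simp add: fps_X_power_mult_nth)
    then show "x \<in> L n" using shiftO[OF f(1), of "n - m"] that by (auto simp: L_def)
  qed
  have "is_ideal (\<Union>m. L m)"
    unfolding R.subspace_def
  proof (intro conjI ballI allI)
    show "0 \<in> (\<Union>m. L m)" using R.subspace_0[OF Lsub] by auto
  next
    fix x y assume "x \<in> (\<Union>m. L m)" "y \<in> (\<Union>m. L m)"
    then obtain i j where "x \<in> L i" "y \<in> L j" by auto
    then have "x \<in> L (max i j)" "y \<in> L (max i j)" using Lmono[of i "max i j"] Lmono[of j "max i j"] by auto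
    then show "x + y \<in> (\<Union>m. L m)" using R.subspace_add[OF Lsub] by blast
  next
    fix c x assume "x \<in> (\<Union>m. L m)"
    then show "c * x \<in> (\<Union>m. L m)" using R.subspace_scale[OF Lsub] by blast
  qed
  then obtain C where C: "finite C" "C \<subseteq> (\<Union>m. L m)" "(\<Union>m. L m) \<subseteq> ideal_span C"
    using noeth unfolding fg_submodules_def by blast
  from C(2) have "\<forall>c\<in>C. \<exists>m. c \<in> L m" by auto
  then obtain mc where mc: "\<And>c. c \<in> C \<Longrightarrow> c \<in> L (mc c)" by metis
  obtain m0 where m0: "\<And>c. c \<in> C \<Longrightarrow> mc c \<le> m0"
    using finite_nat_set_iff_bounded_le[of "mc ` C"] C(1) by auto
  have "C \<subseteq> L m0" using mc m0 Lmono by blast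
  then have stab: "L m \<subseteq> L m0" for m
    using C(3) R.span_minimal[OF _ Lsub] by blast
  have "\<exists>G. finite G \<and> G \<subseteq> Od m \<and> L m \<subseteq> ideal_span ((\<lambda>g. fps_nth g m) ` G)" for m
  proof -
    obtain D where D: "finite D" "D \<subseteq> L m" "L m \<subseteq> ideal_span D"
      using noeth[unfolded fg_submodules_def, rule_format, OF Lsub] by blast
    obtain G where "G \<subseteq> Od m" "finite G" "D = (\<lambda>g. fps_nth g m) ` G"
      using finite_subset_image[OF D(1) D(2)[unfolded L_def]] by blast
    with D show ?thesis by blast
  qed
  then obtain G where G: "\<And>m. finite (G m)" "\<And>m. G m \<subseteq> Od m"
    "\<And>m. L m \<subseteq> ideal_span ((\<lambda>g. fps_nth g m) ` G m)" by metis
  have comb: "\<exists>u. x = (\<Sum>g\<in>G m. u g * fps_nth g m)" if "x \<in> L m" for x m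
  proof -
    have "x \<in> ideal_span ((\<lambda>g. fps_nth g m) ` G m)" using G(3) that by auto
    then show ?thesis
    proof (induction rule: R.span_induct_alt)
      case base
      show ?case by (intro exI[of _ "\<lambda>_. 0"]) simp
    next
      case (step c x y)
      then obtain u g where u: "y = (\<Sum>g\<in>G m. u g * fps_nth g m)" and g: "g \<in> G m" "x = fps_nth g m" by auto
      have "c * x + y = (\<Sum>h\<in>G m. (u h + (if h = g then c else 0)) * fps_nth h m)"
        using g G(1) by (simp add: u ring_distribs sum.distrib if_distrib[of "\<lambda>z. z * _"] cong: if_cong)
      then show ?case by (intro exI[of _ "\<lambda>h. u h + (if h = g then c else 0)"])
    qed
  qed
  define B where "B = (\<Union>m\<le>m0. G m)"
  have Bfin: "finite B" unfolding B_def using G(1) by auto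
  have BN: "B \<subseteq> N" unfolding B_def using G(2) by (auto simp: Od_def)
  have high: "f \<in> ideal_span B" if f: "f \<in> Od m0" for f
  proof -
    have "\<exists>u. r - (\<Sum>g\<in>G m0. fps_const (u g) * (fps_X ^ t * g)) \<in> Od (Suc (m0 + t))"
      if r: "r \<in> Od (m0 + t)" for r t
    proof -
      have "fps_nth r (m0 + t) \<in> L m0" using stab r by (auto simp: L_def)
      then obtain u where u: "fps_nth r (m0 + t) = (\<Sum>g\<in>G m0. u g * fps_nth g m0)" using comb by blast
      let ?s = "\<Sum>g\<in>G m0. fps_const (u g) * (fps_X ^ t * g)"
      have "?s \<in> Od (m0 + t)"
      proof (rule M.subspace_sum[OF Osub])
        fix g assume "g \<in> G m0"
        then have "fps_X ^ t * g \<in> Od (m0 + t)" using G(2) shiftO by blast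
        then show "fps_const (u g) * (fps_X ^ t * g) \<in> Od (m0 + t)" by (rule M.subspace_scale[OF Osub])
      qed
      then have "r - ?s \<in> Od (m0 + t)" using r M.subspace_diff[OF Osub] by blast
      moreover have "fps_nth (fps_const a * (fps_X ^ t * g)) (m0 + t) = a * fps_nth g m0" for a g
        by (subst fps_mult_left_const_nth) (simp add: fps_X_power_mult_nth)
      then have "fps_nth ?s (m0 + t) = fps_nth r (m0 + t)"
        unfolding fps_sum_nth u by (intro sum.cong refl)
      then have "fps_nth (r - ?s) (m0 + t) = 0" by (simp only: fps_sub_nth diff_self)
      ultimately show ?thesis by (auto simp: Od_def less_Suc_eq)
    qed
    then obtain U where U: "\<And>r t. r \<in> Od (m0 + t) \<Longrightarrow>
        r - (\<Sum>g\<in>G m0. fps_const (U r t g) * (fps_X ^ t * g)) \<in> Od (Suc (m0 + t))" by metis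
    define r where "r = rec_nat f (\<lambda>t r. r - (\<Sum>g\<in>G m0. fps_const (U r t g) * (fps_X ^ t * g)))"
    have r0: "r 0 = f" and rS: "r (Suc t) = r t - (\<Sum>g\<in>G m0. fps_const (U (r t) t g) * (fps_X ^ t * g))" for t
      by (simp_all add: r_def)
    have rO: "r t \<in> Od (m0 + t)" for t
      by (induction t) (use f U in \<open>auto simp: r0 rS\<close>)
    define q where "q g = Abs_fps (\<lambda>t. U (r t) t g)" for g
    have part: "f - r T = (\<Sum>g\<in>G m0. fps_cutoff T (q g) * g)" for T
    proof (induction T)
      case 0 then show ?case by (simp add: r0)
    next
      case (Suc T)
      have cut: "fps_cutoff (Suc T) (q g) = fps_cutoff T (q g) + fps_const (U (r T) T g) * fps_X ^ T" for g
        by (rule fps_ext) (auto simp: q_def less_Suc_eq)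
      have "f - r (Suc T) = (f - r T) + (\<Sum>g\<in>G m0. fps_const (U (r T) T g) * (fps_X ^ T * g))"
        by (simp add: rS)
      then show ?case by (simp only: Suc cut ring_distribs sum.distrib mult.assoc)
    qed
    have "f = (\<Sum>g\<in>G m0. q g * g)"
    proof (rule fps_ext)
      fix n
      have "fps_nth (r (Suc n)) n = 0" using rO[of "Suc n"] by (auto simp: Od_def)
      then have "fps_nth f n = fps_nth (f - r (Suc n)) n" by simp
      also have "\<dots> = fps_nth (\<Sum>g\<in>G m0. q g * g) n"
        unfolding part by (simp add: fps_sum_nth fps_mult_nth)
      finally show "fps_nth f n = fps_nth (\<Sum>g\<in>G m0. q g * g) n" .
    qed
    moreover have "(\<Sum>g\<in>G m0. q g * g) \<in> ideal_span B"
      by (intro M.span_sum M.span_scale M.span_base) (auto simp: B_def)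
    ultimately show ?thesis by simp
  qed
  have "Od m \<subseteq> ideal_span B" if "m \<le> m0" for m
    using that
  proof (induction rule: inc_induct)
    case base then show ?case using high by auto
  next
    case (step m)
    show ?case
    proof
      fix f assume f: "f \<in> Od m"
      then obtain u where u: "fps_nth f m = (\<Sum>g\<in>G m. u g * fps_nth g m)"
        using comb[of "fps_nth f m" m] by (auto simp: L_def)
      let ?s = "\<Sum>g\<in>G m. fps_const (u g) * g"
      have "?s \<in> Od m" using G(2) by (intro M.subspace_sum[OF Osub] M.subspace_scale[OF Osub]) blast
      then have "f - ?s \<in> Od m" using f M.subspace_diff[OF Osub] by blast
      moreover have "fps_nth (f - ?s) m = 0" by (simp add: fps_sum_nth u)
      ultimately have "f - ?s \<in> Od (Suc m)" by (auto simp: Od_def less_Suc_eq)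
      then have "f - ?s \<in> ideal_span B" using step by auto
      moreover have "?s \<in> ideal_span B" using step
        by (intro M.span_sum M.span_scale M.span_base) (auto simp: B_def)
      ultimately show "f \<in> ideal_span B" using M.span_add by fastforce
    qed
  qed
  from this[of 0] have "N \<subseteq> ideal_span B" by (auto simp: Od_def)
  then show "\<exists>B. finite B \<and> B \<subseteq> N \<and> N \<subseteq> ideal_span B" using Bfin BN by blast
qed

section \<open>Linear compactness\<close>

text \<open>A decreasing sequence of nonempty affine sets has a common point up to closure in the product
  topology. The coordinates of the point are chosen one at a time: among the points with the
  coordinates chosen so far, the values of the next coordinate form, for each set of the sequence, a
  single value or the whole field, so that these sets of values have a common element.\<close>

lemma linear_compactness:
  fixes C :: "nat \<Rightarrow> (nat \<Rightarrow> 'k::field) set"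
  assumes dec: "\<And>m n. m \<le> n \<Longrightarrow> C n \<subseteq> C m" and ne: "\<And>n. C n \<noteq> {}"
    and affine: "\<And>n u v c. u \<in> C n \<Longrightarrow> v \<in> C n \<Longrightarrow> (\<lambda>j. c * u j + (1 - c) * v j) \<in> C n"
  shows "\<exists>z. \<forall>n j. \<exists>u\<in>C n. \<forall>i<j. u i = z i"
proof -
  define Q where "Q j z \<longleftrightarrow> (\<forall>n. \<exists>u\<in>C n. \<forall>i<j. u i = z i)" for j z
  have step: "\<exists>z'. Q (Suc j) z' \<and> (\<forall>i<j. z' i = z i)" if Qz: "Q j z" for j z
  proof -
    define p where "p n = (\<lambda>u. u j) ` {u \<in> C n. \<forall>i<j. u i = z i}" for n
    have pne: "p n \<noteq> {}" for n using Qz by (auto simp: p_def Q_def)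
    have pdec: "p n \<subseteq> p m" if "m \<le> n" for m n using dec[OF that] by (auto simp: p_def)
    have pall: "y \<in> p n" if ab: "a \<in> p n" "b \<in> p n" "a \<noteq> b" for a b y n
    proof -
      obtain u v where u: "u \<in> C n" "\<forall>i<j. u i = z i" "a = u j"
        and v: "v \<in> C n" "\<forall>i<j. v i = z i" "b = v j" using ab by (auto simp: p_def)
      define c where "c = (y - b) / (a - b)"
      have "c * a + (1 - c) * b = c * (a - b) + b" by (simp add: algebra_simps)
      also have "\<dots> = y" using ab by (simp add: c_def)
      finally have "c * u j + (1 - c) * v j = y" using u v by simp
      moreover have "(\<lambda>j. c * u j + (1 - c) * v j) \<in> {u \<in> C n. \<forall>i<j. u i = z i}"
        using affine[OF u(1) v(1)] u(2) v(2) by (auto simp: algebra_simps)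
      ultimately show ?thesis unfolding p_def by (metis (no_types, lifting) image_eqI)
    qed
    obtain c where c: "\<And>n. c \<in> p n"
    proof (cases "\<forall>n. p n = UNIV")
      case True then show ?thesis using that by auto
    next
      case False
      then obtain n0 y where y: "y \<notin> p n0" by auto
      obtain c where c0: "c \<in> p n0" using pne by auto
      have "c \<in> p n" for n
      proof -
        obtain d where d: "d \<in> p (max n n0)" using pne by auto
        then have "d \<in> p n0" "d \<in> p n" using pdec[of n0 "max n n0"] pdec[of n "max n n0"] by auto
        then show ?thesis using pall[OF c0] y by blast
      qed
      then show ?thesis using that by blast
    qed
    have "Q (Suc j) (z(j := c))"
      unfolding Q_def
    proof
      fix n
      obtain u where "u \<in> C n" "\<forall>i<j. u i = z i" "u j = c" using c[of n] by (auto simp: p_def)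
      then show "\<exists>u\<in>C n. \<forall>i<Suc j. u i = (z(j := c)) i" by (auto simp: less_Suc_eq)
    qed
    then show ?thesis by (intro exI[of _ "z(j := c)"]) auto
  qed
  have "\<exists>f. \<forall>j. Q j (f j) \<and> (\<forall>i<j. f (Suc j) i = f j i)"
  proof (rule dependent_nat_choice)
    show "\<exists>z. Q 0 z" using ne by (auto simp: Q_def ex_in_conv)
  qed (use step in blast)
  then obtain f where f: "\<And>j. Q j (f j)" "\<And>j i. i < j \<Longrightarrow> f (Suc j) i = f j i" by blast
  have agree: "f j i = f (Suc i) i" if "i < j" for i j
    using that by (induction j) (auto simp: less_Suc_eq f(2))
  show ?thesis
  proof (intro exI[of _ "\<lambda>i. f (Suc i) i"] allI)
    fix n j
    obtain u where u: "u \<in> C n" "\<forall>i<j. u i = f j i" using f(1)[of j] unfolding Q_def by blast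
    then show "\<exists>u\<in>C n. \<forall>i<j. u i = f (Suc i) i" using agree by (metis)
  qed
qed

section \<open>The ring of the example\<close>

type_synonym 'k mat2 = "'k fps fps ^ 2 ^ 2"

lemma mat2_eqI:
  fixes A B :: "'a ^ 2 ^ 2"
  assumes "A $ 1 $ 1 = B $ 1 $ 1" "A $ 1 $ 2 = B $ 1 $ 2" "A $ 2 $ 1 = B $ 2 $ 1" "A $ 2 $ 2 = B $ 2 $ 2"
  shows "A = B"
  using assms by (simp add: vec_eq_iff forall_2)

lemma mat2_mult_nth:
  fixes A B :: "'a::semiring_1 ^ 2 ^ 2"
  shows "(A ** B) $ i $ j = A $ i $ 1 * B $ 1 $ j + A $ i $ 2 * B $ 2 $ j"
  by (simp add: matrix_matrix_mult_def sum_2)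

lemma mat2_1_nth:
  "(mat 1 :: 'a::semiring_1 ^ 2 ^ 2) $ 1 $ 1 = 1" "(mat 1 :: 'a::semiring_1 ^ 2 ^ 2) $ 1 $ 2 = 0"
  "(mat 1 :: 'a::semiring_1 ^ 2 ^ 2) $ 2 $ 1 = 0" "(mat 1 :: 'a::semiring_1 ^ 2 ^ 2) $ 2 $ 2 = 1"
  by (simp_all add: mat_def)

definition mat2 :: "'a::zero \<Rightarrow> 'a \<Rightarrow> 'a \<Rightarrow> 'a \<Rightarrow> 'a ^ 2 ^ 2" where
  "mat2 a b c d = vector [vector [a, b], vector [c, d]]"

lemma mat2_nth [simp]:
  "mat2 a b c d $ 1 $ 1 = a" "mat2 a b c d $ 1 $ 2 = b"
  "mat2 a b c d $ 2 $ 1 = c" "mat2 a b c d $ 2 $ 2 = d"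

  by (simp_all add: mat2_def)

text \<open>The ring homomorphism \<open>h(x,y) \<mapsto> h(x\<^sup>2,y)\<close>, first on \<open>k[[x]]\<close> and then on \<open>k[[x]][[y]]\<close>.\<close>

definition sq :: "'k::field fps \<Rightarrow> 'k fps" where
  "sq f = f oo fps_X ^ 2"

definition sqx :: "'k::field fps fps \<Rightarrow> 'k fps fps" where
  "sqx h = Abs_fps (\<lambda>n. sq (fps_nth h n))"

lemma sq_ring_hom:
  "sq (f + g) = sq f + sq g" "sq (f * g) = sq f * sq g" "sq (- f) = - sq f"
  "sq (f - g) = sq f - sq g" "sq 0 = 0" "sq 1 = 1" "sq (fps_const c) = fps_const c"
  by (simp_all add: sq_def fps_compose_add_distrib fps_compose_mult_distrib fps_compose_uminus
      fps_compose_sub_distrib)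

lemma sq_sum: "sq (\<Sum>i\<in>A. f i) = (\<Sum>i\<in>A. sq (f i))"
  by (induction A rule: infinite_finite_induct) (simp_all add: sq_ring_hom)

lemma sq_nth: "fps_nth (sq f) n = (if even n then fps_nth f (n div 2) else 0)"
proof -
  have "fps_nth (sq f) n = (\<Sum>i=0..n. if n = 2 * i then fps_nth f i else 0)"
    unfolding sq_def fps_compose_nth by (intro sum.cong refl) (simp add: flip: power_mult)
  also have "\<dots> = (if even n then fps_nth f (n div 2) else 0)"
  proof (cases "even n")
    case True
    then obtain m where m: "n = 2 * m" by auto
    show ?thesis unfolding m by (simp add: sum.delta')
  qed (auto intro!: sum.neutral)
  finally show ?thesis .
qed

lemma sqx_nth [simp]: "fps_nth (sqx h) n = sq (fps_nth h n)"
  by (simp add: sqx_def)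

lemma sqx_ring_hom:
  "sqx (f + g) = sqx f + sqx g" "sqx (f * g) = sqx f * sqx g" "sqx 0 = 0" "sqx 1 = 1"
  by (rule fps_ext, simp add: sq_ring_hom fps_mult_nth sq_sum)+

lemma sqx_const: "sqx (fps_const f) = fps_const (sq f)"
  by (rule fps_ext) (simp add: sq_ring_hom)

lemma sqx_X: "sqx fps_X = fps_X"
  by (rule fps_ext) (simp add: fps_X_def sq_ring_hom)

lemma sqx_power: "sqx (h ^ n) = sqx h ^ n"
  by (induction n) (simp_all add: sqx_ring_hom)

text \<open>For a matrix of the example ring these are the series \<open>f\<close> and \<open>g\<close> of its presentation.\<close>

definition res_f :: "'k::field mat2 \<Rightarrow> 'k fps" where
  "res_f A = fps_nth (A $ 1 $ 1) 0"

definition res_g :: "'k::field mat2 \<Rightarrow> 'k fps" where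
  "res_g A = fps_nth (A $ 1 $ 2) 0"

lemma example_ring_simps [simp]:
  "\<one>\<^bsub>example_ring\<^esub> = mat 1" "\<zero>\<^bsub>example_ring\<^esub> = 0"
  "A \<otimes>\<^bsub>example_ring\<^esub> B = A ** B" "A \<oplus>\<^bsub>example_ring\<^esub> B = A + B"
  "c \<odot>\<^bsub>example_ring\<^esub> A = (\<chi> i j. fps_const (fps_const c) * A $ i $ j)"
  by (simp_all add: example_ring_def matrix_algebra_def)

lemma carrier_example_ring:
  "A \<in> carrier example_ring \<longleftrightarrow>
     fps_nth (A $ 2 $ 1) 0 = 0 \<and> fps_nth (A $ 2 $ 2) 0 = sq (fps_nth (A $ 1 $ 1) 0)"
proof
  assume "A \<in> carrier example_ring"
  then show "fps_nth (A $ 2 $ 1) 0 = 0 \<and> fps_nth (A $ 2 $ 2) 0 = sq (fps_nth (A $ 1 $ 1) 0)"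
    by (auto simp: example_ring_def sq_def)
next
  assume *: "fps_nth (A $ 2 $ 1) 0 = 0 \<and> fps_nth (A $ 2 $ 2) 0 = sq (fps_nth (A $ 1 $ 1) 0)"
  have shift: "h = fps_const (fps_nth h 0) + fps_X * fps_shift 1 h" for h :: "'a fps fps"
    by (rule fps_ext) simp
  have "A = vector [vector [fps_const (res_f A), fps_const (res_g A)],
              vector [0, fps_const (res_f A oo fps_X ^ 2)]]
          + (\<chi> i j. fps_X * (\<chi> i j. fps_shift 1 (A $ i $ j)) $ i $ j)"
    using * by (intro mat2_eqI) (subst shift, simp add: res_f_def res_g_def sq_def)+
  then have "\<exists>f g B. A = vector [vector [fps_const f, fps_const g], vector [0, fps_const (f oo fps_X ^ 2)]]
          + (\<chi> i j. fps_X * B $ i $ j)" by blast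
  then show "A \<in> carrier example_ring" by (simp add: example_ring_def)
qed

lemma example_ring_memI:
  "fps_nth (A $ 2 $ 1) 0 = 0 \<Longrightarrow> fps_nth (A $ 2 $ 2) 0 = sq (fps_nth (A $ 1 $ 1) 0) \<Longrightarrow>
     A \<in> carrier example_ring"
  by (simp add: carrier_example_ring)

lemma example_ring_closed:
  assumes "A \<in> carrier example_ring" "B \<in> carrier example_ring"
  shows "A + B \<in> carrier example_ring" "A - B \<in> carrier example_ring" "- A \<in> carrier example_ring"
    "A ** B \<in> carrier example_ring" "(\<chi> i j. fps_const (fps_const c) * A $ i $ j) \<in> carrier example_ring"
  using assms by (simp_all add: carrier_example_ring mat2_mult_nth sq_ring_hom)

lemma example_ring_01: "0 \<in> carrier example_ring" "mat 1 \<in> carrier example_ring"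
  by (simp_all add: carrier_example_ring mat2_1_nth sq_ring_hom)

lemma res_f_simps:
  "res_f (A + B) = res_f A + res_f B" "res_f (A - B) = res_f A - res_f B" "res_f (- A) = - res_f A"
  "res_f 0 = 0" "res_f (mat 1) = 1"
  "res_f (\<chi> i j. fps_const (fps_const c) * A $ i $ j) = fps_const c * res_f A"
  by (simp_all add: res_f_def mat2_1_nth)

lemma res_g_simps:
  "res_g (A + B) = res_g A + res_g B" "res_g (A - B) = res_g A - res_g B" "res_g (- A) = - res_g A"
  "res_g 0 = 0"
  by (simp_all add: res_g_def)

lemma res_f_mult: "B \<in> carrier example_ring \<Longrightarrow> res_f (A ** B) = res_f A * res_f B"
  by (simp add: res_f_def mat2_mult_nth carrier_example_ring)

lemma res_g_mult:
  "B \<in> carrier example_ring \<Longrightarrow> res_g (A ** B) = res_f A * res_g B + res_g A * sq (res_f B)"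
  by (simp add: res_f_def res_g_def mat2_mult_nth carrier_example_ring)

lemma ring_example_ring: "ring (example_ring :: ('k::field, 'k mat2) module)"
proof (rule ringI)
  show "abelian_group (example_ring :: ('k, 'k mat2) module)"
    by (rule abelian_groupI) (auto simp: example_ring_closed example_ring_01 add.assoc add.commute
        intro: bexI[of _ "- _"])
  show "monoid (example_ring :: ('k, 'k mat2) module)"
    by (rule monoidI) (auto simp: example_ring_closed example_ring_01 matrix_mul_assoc)
qed (auto simp: vec_eq_iff mat2_mult_nth algebra_simps)

lemma a_inv_example_ring [simp]:
  assumes "A \<in> carrier example_ring" shows "\<ominus>\<^bsub>example_ring\<^esub> A = - A"
proof -
  interpret ring example_ring by (rule ring_example_ring)
  show ?thesis by (rule minus_equality) (use assms in \<open>auto simp: example_ring_closed\<close>)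
qed

lemma a_minus_example_ring [simp]:
  "A \<in> carrier example_ring \<Longrightarrow> B \<in> carrier example_ring \<Longrightarrow> A \<ominus>\<^bsub>example_ring\<^esub> B = A - B"
  by (simp add: a_minus_def)

lemma finsum_example_ring:
  assumes "finite I" "\<And>i. i \<in> I \<Longrightarrow> f i \<in> carrier example_ring"
  shows "finsum example_ring f I = (\<Sum>i\<in>I. f i) \<and> (\<Sum>i\<in>I. f i) \<in> carrier example_ring"
proof -
  interpret ring example_ring by (rule ring_example_ring)
  show ?thesis using assms
  proof (induction I rule: finite_induct)
    case empty then show ?case using finsum_empty example_ring_01 by simp
  next
    case (insert i I)
    then show ?case by (simp add: Pi_def example_ring_closed)
  qed
qed

lemma additive_subgroup_example_ring:
  assumes "additive_subgroup I example_ring"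
  shows "I \<subseteq> carrier example_ring" "0 \<in> I" "\<And>A B. A \<in> I \<Longrightarrow> B \<in> I \<Longrightarrow> A + B \<in> I"
    "\<And>A. A \<in> I \<Longrightarrow> - A \<in> I" "\<And>A B. A \<in> I \<Longrightarrow> B \<in> I \<Longrightarrow> A - B \<in> I"
proof -
  interpret ring example_ring by (rule ring_example_ring)
  interpret additive_subgroup I example_ring by fact
  show sub: "I \<subseteq> carrier example_ring" by (rule a_subset)
  show "0 \<in> I" using zero_closed by simp
  show add: "A + B \<in> I" if "A \<in> I" "B \<in> I" for A B using a_closed[OF that] by simp
  show neg: "- A \<in> I" if "A \<in> I" for A using a_inv_closed[OF that] sub that by auto
  show "A - B \<in> I" if "A \<in> I" "B \<in> I" for A B using add[OF that(1) neg[OF that(2)]] by simp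
qed

lemma additive_subgroup_example_ringI:
  assumes "I \<subseteq> carrier example_ring" "0 \<in> I" "\<And>A B. A \<in> I \<Longrightarrow> B \<in> I \<Longrightarrow> A + B \<in> I"
    "\<And>A. A \<in> I \<Longrightarrow> - A \<in> I"
  shows "additive_subgroup I example_ring"
proof
  show "inv\<^bsub>add_monoid example_ring\<^esub> A \<in> I" if "A \<in> I" for A
  proof -
    have "- A = \<ominus>\<^bsub>example_ring\<^esub> A" using assms(1) that by auto
    then show ?thesis using assms(4)[OF that] by (simp add: a_inv_def)
  qed
qed (use assms in auto)

lemma ring_of_type_algebra_simps [simp]:
  "carrier (ring_of_type_algebra :: 'a::ring_1 ring) = UNIV"
  "\<zero>\<^bsub>ring_of_type_algebra :: 'a ring\<^esub> = 0" "\<one>\<^bsub>ring_of_type_algebra :: 'a ring\<^esub> = 1"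
  "x \<oplus>\<^bsub>ring_of_type_algebra :: 'a ring\<^esub> y = x + y" "x \<otimes>\<^bsub>ring_of_type_algebra :: 'a ring\<^esub> y = x * y"
  by (simp_all add: ring_of_type_algebra_def)

theorem k_algebra_example_ring:
  "k_algebra ring_of_type_algebra (example_ring :: ('k::field, 'k mat2) module)"
proof -
  interpret ring "example_ring :: ('k, 'k mat2) module" by (rule ring_example_ring)
  have "Module.module ring_of_type_algebra (example_ring :: ('k, 'k mat2) module)"
    by (intro module.intro module_axioms.intro cring_from_type_algebra abelian_group_axioms)
      (auto simp: example_ring_closed vec_eq_iff algebra_simps simp flip: fps_const_add fps_const_mult)
  then show ?thesis unfolding k_algebra_def
    by (auto simp: ring_example_ring vec_eq_iff mat2_mult_nth algebra_simps)
qed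

theorem prime_ring_example_ring: "prime_ring (example_ring :: ('k::field, 'k mat2) module)"
  unfolding prime_ring_def
proof (intro conjI allI impI)
  have "mat 1 \<noteq> (0 :: 'k mat2)" by (metis mat2_1_nth(1) zero_index zero_neq_one)
  then show "carrier (example_ring :: ('k, 'k mat2) module) \<noteq> {\<zero>\<^bsub>example_ring\<^esub>}"
    using example_ring_01(2) by auto
next
  fix I J :: "'k mat2 set"
  assume *: "ideal I example_ring \<and> ideal J example_ring \<and>
    I \<cdot>\<^bsub>example_ring\<^esub> J = {\<zero>\<^bsub>example_ring\<^esub>}"
  interpret I: ideal I example_ring using * by simp
  interpret J: ideal J example_ring using * by simp
  show "I = {\<zero>\<^bsub>example_ring\<^esub>} \<or> J = {\<zero>\<^bsub>example_ring\<^esub>}"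
  proof (rule ccontr)
    assume "\<not> ?thesis"
    then have "I \<noteq> {0}" "J \<noteq> {0}" by simp_all
    moreover have "0 \<in> I" "0 \<in> J"
      using additive_subgroup.zero_closed[OF I.additive_subgroup_axioms]
        additive_subgroup.zero_closed[OF J.additive_subgroup_axioms] by simp_all
    ultimately obtain A B where A: "A \<in> I" "A \<noteq> 0" and B: "B \<in> J" "B \<noteq> 0" by blast
    obtain i p where ip: "A $ i $ p \<noteq> 0" using A(2) by (metis vec_eq_iff zero_index)
    obtain q j where qj: "B $ q $ j \<noteq> 0" using B(2) by (metis vec_eq_iff zero_index)
    \<comment> \<open>The multiple \<open>y E\<^sub>p\<^sub>q\<close> of the matrix unit isolates the product of the two entries.\<close>
    define C :: "'k mat2" where "C = (\<chi> r s. if r = p \<and> s = q then fps_X else 0)"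
    have "C \<in> carrier example_ring" by (simp add: carrier_example_ring C_def sq_ring_hom)
    then have "A ** C \<in> I" using I.I_r_closed[OF A(1)] by simp
    then have "(A ** C) ** B \<in> I \<cdot>\<^bsub>example_ring\<^esub> J"
      using ideal_prod.prod[of "A ** C" I B J example_ring] B by simp
    then have "((A ** C) ** B) $ i $ j = 0" using * by simp
    moreover have "((A ** C) ** B) $ i $ j = A $ i $ p * fps_X * B $ q $ j"
      using exhaust_2[of p] exhaust_2[of q] by (auto simp: mat2_mult_nth C_def)
    ultimately show False using ip qj by simp
  qed
qed

section \<open>The maximal ideal\<close>

definition max_ideal :: "'k::field mat2 set" where
  "max_ideal = {A \<in> carrier example_ring. fps_nth (res_f A) 0 = 0}"

lemma ideal_max_ideal: "ideal max_ideal (example_ring :: ('k::field, 'k mat2) module)"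
proof -
  have "additive_subgroup max_ideal (example_ring :: ('k, 'k mat2) module)"
    by (rule additive_subgroup_example_ringI)
      (auto simp: max_ideal_def example_ring_closed example_ring_01 res_f_simps)
  then show ?thesis
    by (intro idealI ring_example_ring)
      (auto simp: additive_subgroup_def max_ideal_def example_ring_closed res_f_mult)
qed

lemma one_notin_max_ideal: "mat 1 \<notin> max_ideal"
  by (auto simp: max_ideal_def res_f_simps(5))

lemma fps_fps_unit:
  assumes "fps_nth (fps_nth (s :: 'k::field fps fps) 0) 0 \<noteq> 0"
  shows "\<exists>t. s * t = 1"
proof -
  have "fps_nth s 0 * inverse (fps_nth s 0) = 1" using inverse_mult_eq_1'[OF assms] .
  then show ?thesis using fps_right_inverse by blast
qed

text \<open>The inverse in \<open>M\<^sub>2(k[[x,y]])\<close> exists because the determinant has constant term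
  \<open>f(0)\<^sup>2\<close>. Modulo \<open>y\<close> it is upper triangular with diagonal \<open>1/f(x), 1/f(x\<^sup>2)\<close>, hence it lies
  in the ring.\<close>

lemma example_ring_unit:
  assumes A: "A \<in> carrier example_ring" and f0: "fps_nth (res_f A) 0 \<noteq> 0"
  shows "\<exists>B \<in> carrier example_ring. A ** B = mat 1 \<and> B ** A = mat 1"
proof -
  define d where "d = A $ 1 $ 1 * A $ 2 $ 2 - A $ 1 $ 2 * A $ 2 $ 1"
  have d0: "fps_nth d 0 = res_f A * sq (res_f A)"
    using A by (simp add: d_def carrier_example_ring res_f_def)
  then have "fps_nth (fps_nth d 0) 0 \<noteq> 0" using f0 by (simp add: sq_nth)
  then obtain t where t: "d * t = 1" using fps_fps_unit by blast
  define t0 where "t0 = fps_nth t 0"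
  have t0: "res_f A * sq (res_f A) * t0 = 1"
    using arg_cong[OF t, of "\<lambda>s. fps_nth s 0"] by (simp add: d0 t0_def)
  define B where "B = mat2 (t * A $ 2 $ 2) (- (t * A $ 1 $ 2)) (- (t * A $ 2 $ 1)) (t * A $ 1 $ 1)"
  have "sq (t0 * sq (res_f A)) * sq (res_f A) = t0 * res_f A * sq (res_f A)"
    using arg_cong[OF t0, of sq] t0 by (simp add: sq_ring_hom mult_ac)
  moreover have "sq (res_f A) \<noteq> 0" using t0 by auto
  ultimately have "t0 * res_f A = sq (t0 * sq (res_f A))" by (metis mult_right_cancel)
  then have "B \<in> carrier example_ring"
    using A by (intro example_ring_memI) (auto simp: B_def carrier_example_ring t0_def res_f_def)
  moreover have "A ** B = mat 1"
    using t by (intro mat2_eqI) (auto simp: mat2_mult_nth mat2_1_nth B_def d_def algebra_simps)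
  moreover have "B ** A = mat 1"
    using t by (intro mat2_eqI) (auto simp: mat2_mult_nth mat2_1_nth B_def d_def algebra_simps)
  ultimately show ?thesis by blast
qed

lemma right_ideal_le_max_ideal:
  assumes I: "right_ideal I example_ring" and ne: "I \<noteq> carrier example_ring"
  shows "I \<subseteq> max_ideal"
proof (rule ccontr)
  note sub = additive_subgroup_example_ring[OF I[unfolded right_ideal_def, THEN conjunct1]]
  assume "\<not> I \<subseteq> max_ideal"
  then obtain A where A: "A \<in> I" "A \<notin> max_ideal" by auto
  then obtain B where B: "B \<in> carrier example_ring" "A ** B = mat 1"
    using example_ring_unit[of A] sub(1) by (auto simp: max_ideal_def)
  have mul: "C ** D \<in> I" if "C \<in> I" "D \<in> carrier example_ring" for C D
    using I that by (auto simp: right_ideal_def)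
  have "mat 1 \<in> I" using mul[OF A(1) B(1)] B(2) by simp
  then have "C \<in> I" if "C \<in> carrier example_ring" for C using mul[of "mat 1" C] that by simp
  then show False using ne sub(1) by blast
qed

text \<open>Everything outside the ideal \<open>f(0) = 0\<close> is a unit, so this ideal is the only maximal right ideal.\<close>

lemma jacobson_radical_example_ring:
  "jacobson_radical (example_ring :: ('k::field, 'k mat2) module) = max_ideal"
proof -
  let ?R = "example_ring :: ('k, 'k mat2) module"
  interpret ideal max_ideal ?R by (rule ideal_max_ideal)
  have ri: "right_ideal max_ideal ?R"
    using I_r_closed by (auto simp: right_ideal_def additive_subgroup_axioms)
  have ne: "max_ideal \<noteq> carrier ?R" using one_notin_max_ideal example_ring_01(2) by auto
  have "maximal_right_ideal I ?R \<longleftrightarrow> I = max_ideal" for I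
  proof
    assume "maximal_right_ideal I ?R"
    then show "I = max_ideal"
      using right_ideal_le_max_ideal[of I] ri ne unfolding maximal_right_ideal_def by metis
  next
    assume "I = max_ideal"
    then show "maximal_right_ideal I ?R"
      using ri ne right_ideal_le_max_ideal unfolding maximal_right_ideal_def by blast
  qed
  then have "jacobson_radical ?R = {x \<in> carrier ?R. x \<in> max_ideal}"
    by (simp add: jacobson_radical_def)
  also have "{x \<in> carrier ?R. x \<in> max_ideal} = max_ideal" using a_subset by blast
  finally show ?thesis .
qed

theorem local_ring_example_ring: "local_ring (example_ring :: ('k::field, 'k mat2) module)"
proof -
  let ?R = "example_ring :: ('k, 'k mat2) module"
  define Q where "Q = ?R Quot max_ideal"
  interpret I: ideal max_ideal ?R by (rule ideal_max_ideal)
  interpret Q: ring Q unfolding Q_def by (rule I.quotient_is_ring)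
  have ne: "\<one>\<^bsub>Q\<^esub> \<noteq> \<zero>\<^bsub>Q\<^esub>"
  proof
    assume "\<one>\<^bsub>Q\<^esub> = \<zero>\<^bsub>Q\<^esub>"
    then have "max_ideal +>\<^bsub>?R\<^esub> mat 1 = max_ideal" by (simp add: Q_def FactRing_def)
    then have "mat 1 \<in> (max_ideal :: 'k mat2 set)"
      using I.a_rcos_self[of "mat 1"] example_ring_01(2) by simp
    then show False using one_notin_max_ideal by blast
  qed
  have units: "\<forall>C \<in> carrier Q - {\<zero>\<^bsub>Q\<^esub>}. C \<in> Units Q"
  proof
    fix C assume "C \<in> carrier Q - {\<zero>\<^bsub>Q\<^esub>}"
    then have C: "C \<in> carrier Q" "C \<noteq> \<zero>\<^bsub>Q\<^esub>" by auto
    obtain A where A: "A \<in> carrier ?R" "C = max_ideal +>\<^bsub>?R\<^esub> A"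
      using C(1) by (auto simp: Q_def FactRing_def A_RCOSETS_def' a_r_coset_def')
    have "A \<notin> max_ideal" using C(2) A I.a_rcos_const by (auto simp: Q_def FactRing_def)
    then have "fps_nth (res_f A) 0 \<noteq> 0" using A(1) unfolding max_ideal_def by blast
    then obtain B where B: "B \<in> carrier ?R" "A ** B = mat 1" "B ** A = mat 1"
      using example_ring_unit[OF A(1)] by blast
    have "max_ideal +>\<^bsub>?R\<^esub> B \<in> carrier Q" using B(1) by (auto simp: Q_def FactRing_def A_RCOSETS_def' a_r_coset_def')
    moreover have "C \<otimes>\<^bsub>Q\<^esub> (max_ideal +>\<^bsub>?R\<^esub> B) = \<one>\<^bsub>Q\<^esub>" "(max_ideal +>\<^bsub>?R\<^esub> B) \<otimes>\<^bsub>Q\<^esub> C = \<one>\<^bsub>Q\<^esub>"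
      using A B by (simp_all add: Q_def FactRing_def I.rcoset_mult_add)
    ultimately show "C \<in> Units Q" using C(1) unfolding Units_def by blast
  qed
  have "\<zero>\<^bsub>Q\<^esub> \<notin> Units Q"
  proof
    assume "\<zero>\<^bsub>Q\<^esub> \<in> Units Q"
    then obtain Y where "Y \<in> carrier Q" "Y \<otimes>\<^bsub>Q\<^esub> \<zero>\<^bsub>Q\<^esub> = \<one>\<^bsub>Q\<^esub>" unfolding Units_def by blast
    then show False using ne Q.r_null by simp
  qed
  moreover have "Units Q \<subseteq> carrier Q" by (auto simp: Units_def)
  ultimately have "Units Q = carrier Q - {\<zero>\<^bsub>Q\<^esub>}" using units by blast
  then show ?thesis
    unfolding local_ring_def division_ring_def jacobson_radical_example_ring Q_def[symmetric]
    using Q.ring_axioms ne by blast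
qed

section \<open>The ring is noetherian\<close>

text \<open>The elements \<open>diag(h(x,y), h(x\<^sup>2,y))\<close> form a subring isomorphic to \<open>k[[x,y]]\<close>. It is not central,
  but \<open>M\<^sub>2(k[[x,y]])\<close> is finitely generated over it on either side.\<close>

definition tau :: "'k::field fps fps \<Rightarrow> 'k mat2" where
  "tau h = mat2 h 0 0 (sqx h)"

lemma tau_simps:
  "tau (g + h) = tau g + tau h" "tau (g * h) = tau g ** tau h" "tau 0 = 0" "tau 1 = mat 1"
  by (rule mat2_eqI; simp add: tau_def sqx_ring_hom mat2_mult_nth mat2_1_nth)+

lemma tau_sum: "tau (\<Sum>i\<in>A. h i) = (\<Sum>i\<in>A. tau (h i))"
  by (induction A rule: infinite_finite_induct) (simp_all add: tau_simps)

lemma tau_in_carrier: "tau h \<in> carrier example_ring"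
  by (simp add: carrier_example_ring tau_def)

lemma res_f_tau: "res_f (tau h) = fps_nth h 0"
  by (simp add: res_f_def tau_def)

lemma module_right_tau: "Modules.module (\<lambda>h (A :: 'k::field mat2). A ** tau h)"
proof
  fix g h :: "'k fps fps" and A B :: "'k mat2"
  show "A ** tau g ** tau h = A ** tau (h * g)"
    by (simp add: mult.commute tau_simps flip: matrix_mul_assoc)
qed (simp_all add: tau_simps vec_eq_iff mat2_mult_nth algebra_simps)

lemma module_left_tau: "Modules.module (\<lambda>h (A :: 'k::field mat2). tau h ** A)"
  by unfold_locales (simp_all add: tau_simps matrix_mul_assoc, simp_all add: vec_eq_iff mat2_mult_nth algebra_simps)

text \<open>The terms with an even and with an odd power of \<open>x\<close>.\<close>

lemma sqx_decomposition: "\<exists>u v. s = sqx u + fps_const fps_X * sqx v"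
proof -
  have "s = sqx (Abs_fps (\<lambda>b. Abs_fps (\<lambda>a. fps_nth (fps_nth s b) (2 * a))))
    + fps_const fps_X * sqx (Abs_fps (\<lambda>b. Abs_fps (\<lambda>a. fps_nth (fps_nth s b) (2 * a + 1))))"
    by (intro fps_ext) (auto simp: sq_nth elim!: oddE)
  then show ?thesis by blast
qed

lemma fg_submodules_power_series: "fg_submodules ((*) :: 'k::field fps fps \<Rightarrow> 'k fps fps \<Rightarrow> 'k fps fps)"
  by (intro fg_submodules_fps fg_submodules_field)

lemma fg_submodules_right_tau: "fg_submodules (\<lambda>h (A :: 'k::field mat2). A ** tau h)"
proof (rule fg_submodules_of_fg[OF module_right_tau fg_submodules_power_series])
  interpret Modules.module "\<lambda>h (A :: 'k mat2). A ** tau h" by (rule module_right_tau)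
  let ?x = "fps_const fps_X :: 'k fps fps"
  define B :: "'k mat2 set" where
    "B = {mat2 1 0 0 0, mat2 0 0 1 0, mat2 0 1 0 0, mat2 0 ?x 0 0, mat2 0 0 0 1, mat2 0 0 0 ?x}"
  show "finite B" by (simp add: B_def)
  have "A \<in> Modules.module.span (\<lambda>h A. A ** tau h) B" for A
  proof -
    obtain u v where u: "A $ 1 $ 2 = sqx u + ?x * sqx v" using sqx_decomposition by blast
    obtain u' v' where u': "A $ 2 $ 2 = sqx u' + ?x * sqx v'" using sqx_decomposition by blast
    have "A = mat2 1 0 0 0 ** tau (A $ 1 $ 1) + mat2 0 0 1 0 ** tau (A $ 2 $ 1)
      + mat2 0 1 0 0 ** tau u + mat2 0 ?x 0 0 ** tau v + mat2 0 0 0 1 ** tau u' + mat2 0 0 0 ?x ** tau v'"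
      by (rule mat2_eqI) (simp_all add: mat2_mult_nth tau_def u u')
    also have "\<dots> \<in> Modules.module.span (\<lambda>h A. A ** tau h) B"
      by (intro span_add span_scale span_base) (auto simp: B_def)
    finally show ?thesis .
  qed
  then show "Modules.module.span (\<lambda>h A. A ** tau h) B = UNIV" by blast
qed

lemma fg_submodules_left_tau: "fg_submodules (\<lambda>h (A :: 'k::field mat2). tau h ** A)"
proof (rule fg_submodules_of_fg[OF module_left_tau fg_submodules_power_series])
  interpret Modules.module "\<lambda>h (A :: 'k mat2). tau h ** A" by (rule module_left_tau)
  let ?x = "fps_const fps_X :: 'k fps fps"
  define B :: "'k mat2 set" where
    "B = {mat2 1 0 0 0, mat2 0 1 0 0, mat2 0 0 1 0, mat2 0 0 ?x 0, mat2 0 0 0 1, mat2 0 0 0 ?x}"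
  show "finite B" by (simp add: B_def)
  have "A \<in> Modules.module.span (\<lambda>h A. tau h ** A) B" for A
  proof -
    obtain u v where u: "A $ 2 $ 1 = sqx u + ?x * sqx v" using sqx_decomposition by blast
    obtain u' v' where u': "A $ 2 $ 2 = sqx u' + ?x * sqx v'" using sqx_decomposition by blast
    have "A = tau (A $ 1 $ 1) ** mat2 1 0 0 0 + tau (A $ 1 $ 2) ** mat2 0 1 0 0
      + tau u ** mat2 0 0 1 0 + tau v ** mat2 0 0 ?x 0 + tau u' ** mat2 0 0 0 1 + tau v' ** mat2 0 0 0 ?x"
      by (rule mat2_eqI) (simp_all add: mat2_mult_nth tau_def u u' mult.commute)
    also have "\<dots> \<in> Modules.module.span (\<lambda>h A. tau h ** A) B"
      by (intro span_add span_scale span_base) (auto simp: B_def)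
    finally show ?thesis .
  qed
  then show "Modules.module.span (\<lambda>h A. tau h ** A) B = UNIV" by blast
qed

text \<open>One-sided ideals of the example ring are submodules for the action of the subring of all
  \<open>tau h\<close> on that side, so finitely many elements generate them already over this subring.\<close>

lemma fg_ideals_of_submodules:
  assumes "Modules.module scl" "fg_submodules scl"
    and sub: "\<And>J. P J \<Longrightarrow> Modules.module.subspace scl J" and car: "\<And>J. P J \<Longrightarrow> J \<subseteq> C" and I: "P I"
  shows "\<exists>A\<subseteq>C. finite A \<and> I = \<Inter>{J. P J \<and> A \<subseteq> J}"
proof -
  obtain A where A: "finite A" "A \<subseteq> I" "I \<subseteq> Modules.module.span scl A"
    using assms(2) sub[OF I] unfolding fg_submodules_def by blast
  have "I \<subseteq> J" if "P J" "A \<subseteq> J" for J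
    using A(3) Modules.module.span_minimal[OF assms(1) that(2) sub[OF that(1)]] by blast
  then have "I = \<Inter>{J. P J \<and> A \<subseteq> J}" using I A(2) by blast
  then show ?thesis using A(1) subset_trans[OF A(2) car[OF I]] by (intro exI[of _ A] conjI)
qed

theorem noetherian_example_ring: "noetherian (example_ring :: ('k::field, 'k mat2) module)"
proof -
  let ?R = "example_ring :: ('k, 'k mat2) module"
  have "right_noetherian ?R"
    unfolding right_noetherian_def
  proof (intro allI impI)
    fix I assume I: "right_ideal I ?R"
    show "\<exists>A\<subseteq>carrier ?R. finite A \<and> I = \<Inter>{J. right_ideal J ?R \<and> A \<subseteq> J}"
    proof (rule fg_ideals_of_submodules[where P = "\<lambda>J. right_ideal J ?R",
          OF module_right_tau fg_submodules_right_tau _ _ I])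
      fix J assume J: "right_ideal J ?R"
      note sub = additive_subgroup_example_ring[OF J[unfolded right_ideal_def, THEN conjunct1]]
      have mul: "\<forall>C\<in>J. \<forall>D\<in>carrier ?R. C ** D \<in> J" using J by (simp add: right_ideal_def)
      show "J \<subseteq> carrier ?R" by (rule sub)
      show "Modules.module.subspace (\<lambda>h A. A ** tau h) J"
        unfolding Modules.module.subspace_def[OF module_right_tau]
        using sub(2,3) mul tau_in_carrier by blast
    qed
  qed
  moreover have "left_noetherian ?R"
    unfolding left_noetherian_def
  proof (intro allI impI)
    fix I assume I: "left_ideal I ?R"
    show "\<exists>A\<subseteq>carrier ?R. finite A \<and> I = \<Inter>{J. left_ideal J ?R \<and> A \<subseteq> J}"
    proof (rule fg_ideals_of_submodules[where P = "\<lambda>J. left_ideal J ?R",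
          OF module_left_tau fg_submodules_left_tau _ _ I])
      fix J assume J: "left_ideal J ?R"
      note sub = additive_subgroup_example_ring[OF J[unfolded left_ideal_def, THEN conjunct1]]
      have mul: "\<forall>C\<in>J. \<forall>D\<in>carrier ?R. D ** C \<in> J" using J by (simp add: left_ideal_def)
      show "J \<subseteq> carrier ?R" by (rule sub)
      show "Modules.module.subspace (\<lambda>h A. tau h ** A) J"
        unfolding Modules.module.subspace_def[OF module_left_tau]
        using sub(2,3) mul tau_in_carrier by blast
    qed
  qed
  ultimately show ?thesis by (simp add: noetherian_def)
qed

section \<open>A polynomial identity\<close>

text \<open>Hall's identity: the square of a commutator of \<open>2 \<times> 2\<close> matrices over a commutative ring is scalar,
  by Cayley-Hamilton, because a commutator has trace zero.\<close>

lemma hall_identity: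
  fixes A B C :: "'a::comm_ring_1 ^ 2 ^ 2"
  shows "(A ** B - B ** A) ** (A ** B - B ** A) ** C = C ** ((A ** B - B ** A) ** (A ** B - B ** A))"
proof -
  define U where "U = A ** B - B ** A"
  define u where "u = U $ 1 $ 1 * U $ 1 $ 1 + U $ 1 $ 2 * U $ 2 $ 1"
  have "U $ 2 $ 2 = - U $ 1 $ 1" by (simp add: U_def mat2_mult_nth algebra_simps)
  then have "U ** U = mat2 u 0 0 u"
    by (intro mat2_eqI) (simp_all add: mat2_mult_nth u_def algebra_simps)
  then have "U ** U ** C = C ** (U ** U)"
    by (intro mat2_eqI) (simp_all add: mat2_mult_nth mult.commute)
  then show ?thesis by (simp add: U_def)
qed

lemma mat2_mult_distrib:
  fixes A B C :: "'a::comm_ring_1 ^ 2 ^ 2"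
  shows "(A - B) ** C = A ** C - B ** C" "C ** (A - B) = C ** A - C ** B"
    "(A + B) ** C = A ** C + B ** C" "C ** (A + B) = C ** A + C ** B"
  by (simp_all add: vec_eq_iff mat2_mult_nth algebra_simps)

theorem PI_algebra_example_ring:
  "PI_algebra ring_of_type_algebra (example_ring :: ('k::field, 'k mat2) module)"
proof -
  let ?R = "example_ring :: ('k, 'k mat2) module"
  define P :: "nat list set" where "P = {[0,1,0,1,2], [1,0,1,0,2], [2,0,1,1,0], [2,1,0,0,1]}"
  define N :: "nat list set" where "N = {[0,1,1,0,2], [1,0,0,1,2], [2,0,1,0,1], [2,1,0,1,0]}"
  define p :: "nat list \<Rightarrow> 'k" where "p w = (if w \<in> P then 1 else if w \<in> N then - 1 else 0)" for w
  have disj: "P \<inter> N = {}" by (auto simp: P_def N_def)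
  have supp: "{w. p w \<noteq> 0} = P \<union> N" by (auto simp: p_def)
  have fin: "finite P" "finite N" by (auto simp: P_def N_def)
  have "nc_eval ring_of_type_algebra ?R p a = 0" if a: "a \<in> UNIV \<rightarrow> carrier ?R" for a
  proof -
    define m where "m w = foldr (\<lambda>i x. a i ** x) w (mat 1)" for w
    have mR: "m w \<in> carrier ?R" for w
      unfolding m_def using a by (induction w) (auto simp: example_ring_01 intro!: example_ring_closed)
    have "nc_eval ring_of_type_algebra ?R p a
        = (\<Oplus>\<^bsub>?R\<^esub>w \<in> P \<union> N. (\<chi> i j. fps_const (fps_const (p w)) * m w $ i $ j))"
      by (simp add: nc_eval_def supp m_def)
    also have "\<dots> = (\<Sum>w \<in> P \<union> N. (\<chi> i j. fps_const (fps_const (p w)) * m w $ i $ j))"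
      by (rule finsum_example_ring[THEN conjunct1]) (use fin example_ring_closed(5)[OF mR mR] in auto)
    also have "\<dots> = (\<Sum>w\<in>P. m w) - (\<Sum>w\<in>N. m w)"
    proof -
      have "(\<chi> i j. fps_const (fps_const (p w)) * m w $ i $ j) = m w" if "w \<in> P" for w
        using that by (simp add: p_def vec_eq_iff)
      moreover have "(\<chi> i j. fps_const (fps_const (p w)) * m w $ i $ j) = - m w" if "w \<in> N" for w
        using that disj by (auto simp: p_def vec_eq_iff simp flip: fps_const_neg)
      ultimately show ?thesis
        using fin disj by (simp add: sum.union_disjoint sum_negf)
    qed
    also have "\<dots> = 0"
      using hall_identity[of "a 0" "a 1" "a 2"]
      by (simp add: P_def N_def m_def mat2_mult_distrib matrix_mul_assoc algebra_simps)
    finally show ?thesis .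
  qed
  moreover have "p [0,1,0,1,2] \<noteq> 0" by (simp add: p_def P_def)
  ultimately show ?thesis
    unfolding PI_algebra_def using k_algebra_example_ring fin
    by (intro conjI exI[of _ p]) (auto simp: supp)
qed

section \<open>The weight filtration and completeness\<close>

definition coef :: "'k::field mat2 \<Rightarrow> 2 \<Rightarrow> 2 \<Rightarrow> nat \<Rightarrow> nat \<Rightarrow> 'k" where
  "coef A i j a b = fps_nth (fps_nth (A $ i $ j) b) a"

text \<open>The matrix unit \<open>E\<^sub>1\<^sub>2\<close> lies in the maximal ideal but has no power of \<open>x\<close> or \<open>y\<close> in it. Shifting
  the weight by the position of the entry gives it weight one, and makes the weight of a product of
  matrix units additive.\<close>

definition wt :: "2 \<Rightarrow> 2 \<Rightarrow> nat \<Rightarrow> nat \<Rightarrow> int" where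
  "wt i j a b = 2 * int (a + b) + (if j = 1 then 0 else 1) - (if i = 1 then 0 else 1)"

definition W :: "int \<Rightarrow> 'k::field mat2 set" where
  "W n = {A. \<forall>i j a b. wt i j a b < n \<longrightarrow> coef A i j a b = 0}"

lemma coef_eqI: "(\<And>i j a b. coef A i j a b = coef B i j a b) \<Longrightarrow> A = B"
  by (simp add: coef_def vec_eq_iff fps_eq_iff)

lemma coef_simps:
  "coef 0 i j a b = 0" "coef (A + B) i j a b = coef A i j a b + coef B i j a b"
  "coef (A - B) i j a b = coef A i j a b - coef B i j a b"
  "coef (\<chi> i j. fps_const (fps_const c) * A $ i $ j) i j a b = c * coef A i j a b"
  by (simp_all add: coef_def)

lemma WD: "A \<in> W n \<Longrightarrow> wt i j a b < n \<Longrightarrow> coef A i j a b = 0"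
  by (simp add: W_def)

lemma W_add: "A \<in> W n \<Longrightarrow> B \<in> W n \<Longrightarrow> A + B \<in> W n"
  by (simp add: W_def coef_simps)

lemma W_mult:
  assumes A: "A \<in> W m" and B: "B \<in> W n"
  shows "A ** B \<in> W (m + n)"
proof -
  have "coef (A ** B) i j a b = 0" if wt: "wt i j a b < m + n" for i j a b
  proof -
    have "fps_nth (fps_nth (A $ i $ k) b') a' * fps_nth (fps_nth (B $ k $ j) (b - b')) (a - a') = 0"
      if "a' \<le> a" "b' \<le> b" for k a' b'
    proof -
      have "wt i k a' b' + wt k j (a - a') (b - b') = wt i j a b"
        using that by (simp add: wt_def)
      then have "wt i k a' b' < m \<or> wt k j (a - a') (b - b') < n" using wt by linarith
      then show ?thesis using WD[OF A] WD[OF B] by (auto simp: coef_def)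
    qed
    then have "fps_nth (fps_nth (A $ i $ k * B $ k $ j) b) a = 0" for k
      unfolding fps_mult_nth fps_sum_nth by (intro sum.neutral ballI) auto
    then show ?thesis by (simp add: coef_def mat2_mult_nth)
  qed
  then show ?thesis by (simp add: W_def)
qed

lemma carrier_subset_W: "carrier example_ring \<subseteq> W 0"
proof
  fix A :: "'a mat2" assume A: "A \<in> carrier example_ring"
  have "coef A i j a b = 0" if "wt i j a b < 0" for i j a b
  proof -
    have "i = 2 \<and> j = 1 \<and> b = 0"
      using that exhaust_2[of i] exhaust_2[of j] by (auto simp: wt_def split: if_splits)
    then show ?thesis using A by (simp add: coef_def carrier_example_ring)
  qed
  then show "A \<in> W 0" by (simp add: W_def)
qed

lemma max_ideal_subset_W: "max_ideal \<subseteq> W 1"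
proof
  fix A :: "'a mat2" assume A: "A \<in> max_ideal"
  have "coef A i j a b = 0" if "wt i j a b < 1" for i j a b
  proof -
    have "i = 2 \<and> j = 1 \<and> b = 0 \<or> i = j \<and> a = 0 \<and> b = 0"
      using that exhaust_2[of i] exhaust_2[of j] by (auto simp: wt_def split: if_splits)
    then show ?thesis using A exhaust_2[of i]
      by (auto simp: coef_def carrier_example_ring max_ideal_def res_f_def sq_nth)
  qed
  then show "A \<in> W 1" by (simp add: W_def)
qed

lemma ideal_ideal_power: "ideal (ideal_power example_ring max_ideal n) (example_ring :: ('k::field, 'k mat2) module)"
proof -
  interpret ring "example_ring :: ('k, 'k mat2) module" by (rule ring_example_ring)
  show ?thesis
    by (induction n) (simp_all add: oneideal ideal_prod_is_ideal ideal_max_ideal)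
qed

lemma ideal_example_ring:
  assumes "ideal I example_ring"
  shows "I \<subseteq> carrier example_ring" "0 \<in> I" "\<And>A B. A \<in> I \<Longrightarrow> B \<in> I \<Longrightarrow> A + B \<in> I"
    "\<And>A B. A \<in> I \<Longrightarrow> B \<in> I \<Longrightarrow> A - B \<in> I"
    "\<And>A B. A \<in> I \<Longrightarrow> B \<in> carrier example_ring \<Longrightarrow> A ** B \<in> I"
    "\<And>A B. A \<in> I \<Longrightarrow> B \<in> carrier example_ring \<Longrightarrow> B ** A \<in> I"
proof -
  interpret I: ideal I example_ring by fact
  note sub = additive_subgroup_example_ring[OF I.additive_subgroup_axioms]
  show "I \<subseteq> carrier example_ring" "0 \<in> I" "\<And>A B. A \<in> I \<Longrightarrow> B \<in> I \<Longrightarrow> A + B \<in> I"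
    "\<And>A B. A \<in> I \<Longrightarrow> B \<in> I \<Longrightarrow> A - B \<in> I" using sub by auto
  show "A ** B \<in> I" if "A \<in> I" "B \<in> carrier example_ring" for A B using I.I_r_closed[OF that] by simp
  show "B ** A \<in> I" if "A \<in> I" "B \<in> carrier example_ring" for A B using I.I_l_closed[OF that] by simp
qed

lemma ideal_power_subset_W: "ideal_power example_ring max_ideal n \<subseteq> W (int n)"
proof (induction n)
  case 0
  then show ?case using carrier_subset_W by simp
next
  case (Suc n)
  show ?case
  proof
    fix A :: "'a mat2" assume "A \<in> ideal_power example_ring max_ideal (Suc n)"
    then have "A \<in> ideal_power example_ring max_ideal n \<cdot>\<^bsub>example_ring\<^esub> max_ideal" by simp
    then show "A \<in> W (int (Suc n))"
    proof (induction rule: ideal_prod.induct)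
      case (prod A B)
      then have "A ** B \<in> W (int n + 1)" using Suc max_ideal_subset_W by (intro W_mult) auto
      then show ?case by (simp add: add.commute)
    qed (simp add: W_add)
  qed
qed

lemma W_separated: "(\<And>n :: nat. A \<in> W (int n)) \<Longrightarrow> A = 0"
proof (rule coef_eqI)
  fix i j a b assume "\<And>n :: nat. A \<in> W (int n)"
  then have "A \<in> W (int (nat (wt i j a b + 1)))" .
  then show "coef A i j a b = coef 0 i j a b" by (simp add: WD coef_simps)
qed

text \<open>Each condition that defines the ring compares at most two coefficients, so it passes to limits.\<close>

lemma carrier_closed:
  assumes "\<And>n :: nat. \<exists>A \<in> carrier example_ring. A - l \<in> W (int n)"
  shows "l \<in> carrier example_ring"
proof (rule example_ring_memI)
  show "fps_nth (l $ 2 $ 1) 0 = 0"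
  proof (rule fps_ext)
    fix a
    obtain A where A: "A \<in> carrier example_ring" "A - l \<in> W (int (2 * a))" using assms by blast
    have "coef (A - l) 2 1 a 0 = 0" by (rule WD[OF A(2)]) (simp add: wt_def)
    then show "fps_nth (fps_nth (l $ 2 $ 1) 0) a = fps_nth 0 a"
      using A(1) by (simp add: coef_simps) (simp add: coef_def carrier_example_ring)
  qed
  show "fps_nth (l $ 2 $ 2) 0 = sq (fps_nth (l $ 1 $ 1) 0)"
  proof (rule fps_ext)
    fix a
    obtain A where A: "A \<in> carrier example_ring" "A - l \<in> W (int (2 * a + 1))" using assms by blast
    have "coef (A - l) 2 2 a 0 = 0" "coef (A - l) 1 1 (a div 2) 0 = 0"
      by (rule WD[OF A(2)], simp add: wt_def)+
    then show "fps_nth (fps_nth (l $ 2 $ 2) 0) a = fps_nth (sq (fps_nth (l $ 1 $ 1) 0)) a"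
      using A(1) by (simp add: coef_simps) (auto simp: coef_def carrier_example_ring sq_nth)
  qed
qed

abbreviation xS :: "'k::field fps fps" where "xS \<equiv> fps_const fps_X"

text \<open>The coefficients of an element of large weight are divisible by \<open>y\<^sup>n\<^sup>+\<^sup>1\<close> or by \<open>x\<^sup>2\<^sup>n\<close>. The
  exponents leave room for the conditions on the lower row: a factor \<open>y\<close> remains in the second
  summand, and \<open>x\<^sup>n\<close> in the first row corresponds to \<open>x\<^sup>2\<^sup>n\<close> in the second.\<close>

lemma W_decomposition:
  assumes A: "A \<in> carrier example_ring" and W: "A \<in> W (6 * int n + 5)"
  shows "\<exists>B\<in>carrier example_ring. \<exists>C\<in>carrier example_ring.
    A = tau (xS ^ n) ** B + tau (fps_X ^ n) ** C"
proof -
  have zero: "fps_nth (fps_nth (A $ i $ j) b) a = 0" if "b \<le> n" "a < 2 * n" for i j a b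
    using WD[OF W, of i j a b] that by (auto simp: coef_def wt_def)
  define lo where "lo s = Abs_fps (\<lambda>b. if b \<le> n then fps_shift (2 * n) (fps_nth s b) else 0)" for s :: "'a fps fps"
  define hi where "hi s = fps_X * fps_shift (Suc n) s" for s :: "'a fps fps"
  have split: "A $ i $ j = xS ^ (2 * n) * lo (A $ i $ j) + fps_X ^ n * hi (A $ i $ j)" for i j
  proof (intro fps_ext)
    fix b a
    have "fps_nth (fps_X ^ n * hi (A $ i $ j)) b = (if b \<le> n then 0 else fps_nth (A $ i $ j) b)"
    proof -
      have "fps_X ^ n * hi (A $ i $ j) = fps_X ^ Suc n * fps_shift (Suc n) (A $ i $ j)"
        by (simp only: hi_def power_Suc mult_ac)
      then show ?thesis by (simp only: fps_X_power_mult_nth fps_shift_nth) auto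
    qed
    moreover have "fps_nth (xS ^ (2 * n) * lo (A $ i $ j)) b
        = (if b \<le> n then fps_X ^ (2 * n) * fps_shift (2 * n) (fps_nth (A $ i $ j) b) else 0)"
      by (simp add: lo_def)
    moreover have "fps_nth (fps_X ^ (2 * n) * fps_shift (2 * n) (fps_nth (A $ i $ j) b)) a
        = fps_nth (fps_nth (A $ i $ j) b) a" if "b \<le> n"
      using zero that by (simp add: fps_X_power_mult_nth)
    ultimately show "fps_nth (fps_nth (A $ i $ j) b) a
        = fps_nth (fps_nth (xS ^ (2 * n) * lo (A $ i $ j) + fps_X ^ n * hi (A $ i $ j)) b) a"
      by simp
  qed
  define B where "B = mat2 (xS ^ n * lo (A $ 1 $ 1)) (xS ^ n * lo (A $ 1 $ 2)) (lo (A $ 2 $ 1)) (lo (A $ 2 $ 2))"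
  define C where "C = mat2 (hi (A $ 1 $ 1)) (hi (A $ 1 $ 2)) (hi (A $ 2 $ 1)) (hi (A $ 2 $ 2))"
  have "sqx (xS ^ n) = (xS :: 'a fps fps) ^ (2 * n)"
  proof -
    have "sq (fps_X ^ n :: 'a fps) = fps_X ^ (2 * n)"
      by (rule fps_ext) (auto simp: sq_nth elim!: evenE)
    then show ?thesis by (simp add: sqx_const)
  qed
  then have "A = tau (xS ^ n) ** B + tau (fps_X ^ n) ** C"
    by (intro mat2_eqI) (subst split, simp add: tau_def mat2_mult_nth B_def C_def
        sqx_power sqx_X mult_2 power_add mult.assoc)+
  moreover have "C \<in> carrier example_ring"
    by (rule example_ring_memI) (simp_all add: C_def hi_def sq_ring_hom)
  moreover have "B \<in> carrier example_ring"
  proof (rule example_ring_memI)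
    show "fps_nth (B $ 2 $ 1) 0 = 0" using A by (simp add: B_def lo_def carrier_example_ring)
    have "fps_nth (fps_shift (2 * n) (sq (fps_nth (A $ 1 $ 1) 0))) a =
        fps_nth (sq (fps_X ^ n * fps_shift (2 * n) (fps_nth (A $ 1 $ 1) 0))) a" for a
    proof (cases "even a")
      case True
      then obtain c where c: "a = 2 * c" by auto
      show ?thesis using zero[of 0 "c + n" 1 1]
        by (auto simp: c sq_nth fps_X_power_mult_nth add.commute)
    qed (simp add: sq_nth)
    then show "fps_nth (B $ 2 $ 2) 0 = sq (fps_nth (B $ 1 $ 1) 0)"
      using A by (intro fps_ext) (simp add: B_def lo_def carrier_example_ring)
  qed
  ultimately show ?thesis by blast
qed

lemma tau_power_in_ideal_power:
  assumes "fps_nth (fps_nth h 0) 0 = 0"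
  shows "tau (h ^ n) \<in> ideal_power example_ring max_ideal n"
proof (induction n)
  case 0 then show ?case by (simp add: tau_in_carrier)
next
  case (Suc n)
  have "tau h \<in> max_ideal" using assms by (simp add: max_ideal_def tau_in_carrier res_f_tau)
  from ideal_prod.prod[OF Suc this, of example_ring] show ?case
    by (simp add: power_Suc2 tau_simps del: power_Suc)
qed

lemma ideal_W_subset:
  assumes I: "ideal I example_ring" and "tau (xS ^ n) \<in> I" "tau (fps_X ^ n) \<in> I"
  shows "carrier example_ring \<inter> W (6 * int n + 5) \<subseteq> I"
proof
  fix A :: "'a mat2" assume "A \<in> carrier example_ring \<inter> W (6 * int n + 5)"
  then obtain B C where "B \<in> carrier example_ring" "C \<in> carrier example_ring"
    "A = tau (xS ^ n) ** B + tau (fps_X ^ n) ** C" using W_decomposition by blast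
  then show "A \<in> I" using assms(2,3) ideal_example_ring(3,5)[OF I] by simp
qed

text \<open>With \<open>ideal_power_subset_W\<close> this identifies the adic topology of the maximal ideal with the topology
  of coefficientwise convergence, in which limits are computed coefficient by coefficient.\<close>

lemma W_subset_ideal_power:
  "carrier example_ring \<inter> W (6 * int n + 5) \<subseteq> ideal_power example_ring max_ideal n"
  by (intro ideal_W_subset ideal_ideal_power tau_power_in_ideal_power) simp_all

theorem complete_example_ring: "complete_ring (example_ring :: ('k::field, 'k mat2) module)"
  unfolding complete_ring_def jacobson_radical_example_ring adically_complete_def
proof (intro conjI allI impI)
  let ?R = "example_ring :: ('k, 'k mat2) module"
  let ?p = "ideal_power ?R max_ideal"
  show "(\<Inter>n. ?p n) = {\<zero>\<^bsub>?R\<^esub>}"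
  proof
    show "(\<Inter>n. ?p n) \<subseteq> {\<zero>\<^bsub>?R\<^esub>}"
    proof
      fix A assume "A \<in> (\<Inter>n. ?p n)"
      then have "A \<in> W (int n)" for n using ideal_power_subset_W by blast
      then have "A = 0" by (rule W_separated)
      then show "A \<in> {\<zero>\<^bsub>?R\<^esub>}" by simp
    qed
    show "{\<zero>\<^bsub>?R\<^esub>} \<subseteq> (\<Inter>n. ?p n)"
      by (simp add: ideal_example_ring(2)[OF ideal_ideal_power])
  qed
  fix s :: "nat \<Rightarrow> 'k mat2"
  assume s: "(\<forall>n. s n \<in> carrier ?R) \<and> (\<forall>N. \<exists>n0. \<forall>m\<ge>n0. \<forall>n\<ge>n0. s m \<ominus>\<^bsub>?R\<^esub> s n \<in> ?p N)"
  then have sR: "s n \<in> carrier ?R" for n by blast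
  have "\<exists>n0. \<forall>m\<ge>n0. \<forall>n\<ge>n0. s m - s n \<in> ?p N" for N
  proof -
    have "s m \<ominus>\<^bsub>?R\<^esub> s n = s m - s n" for m n using sR by simp
    then show ?thesis using s by metis
  qed
  then have "\<exists>n0. \<forall>m\<ge>n0. \<forall>n\<ge>n0. s m - s n \<in> W (int N)" for N
    using ideal_power_subset_W by blast
  then obtain n0 where n0: "\<And>N m n. m \<ge> n0 N \<Longrightarrow> n \<ge> n0 N \<Longrightarrow> s m - s n \<in> W (int N)" by metis
  define l :: "'k mat2" where
    "l = (\<chi> i j. Abs_fps (\<lambda>b. Abs_fps (\<lambda>a. coef (s (n0 (nat (wt i j a b + 1)))) i j a b)))"
  have l: "coef l i j a b = coef (s (n0 (nat (wt i j a b + 1)))) i j a b" for i j a b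
    by (simp add: l_def coef_def)
  have lim: "s n - l \<in> W (int N)" if n: "n \<ge> n0 N" for n N
  proof -
    have "coef (s n - l) i j a b = 0" if w: "wt i j a b < int N" for i j a b
    proof -
      let ?M = "nat (wt i j a b + 1)"
      let ?k = "max n (n0 ?M)"
      have "coef (s n - s ?k) i j a b = 0" using n by (intro WD[OF n0 w]) auto
      moreover have "coef (s ?k - s (n0 ?M)) i j a b = 0" by (rule WD[OF n0, of ?M]) auto
      ultimately show ?thesis by (simp add: coef_simps l)
    qed
    then show ?thesis by (simp add: W_def)
  qed
  have lR: "l \<in> carrier ?R"
    by (rule carrier_closed) (use lim sR in blast)
  have "s n \<ominus>\<^bsub>?R\<^esub> l \<in> ?p N" if "n \<ge> n0 (6 * N + 5)" for n N
  proof -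
    have "s n - l \<in> W (6 * int N + 5)" using lim[OF that] by (simp add: add.commute)
    then have "s n - l \<in> ?p N" using W_subset_ideal_power sR lR example_ring_closed(2) by blast
    then show ?thesis using sR lR by simp
  qed
  then show "\<exists>l\<in>carrier ?R. \<forall>N. \<exists>n0. \<forall>n\<ge>n0. s n \<ominus>\<^bsub>?R\<^esub> l \<in> ?p N" using lR by blast
qed

section \<open>The growth of f and g under multiplication\<close>

definition ord_ge :: "nat \<Rightarrow> 'k::field fps \<Rightarrow> bool" where
  "ord_ge n f \<longleftrightarrow> (\<forall>j<n. fps_nth f j = 0)"

lemma ord_ge_simps:
  "ord_ge 0 f" "ord_ge n 0" "ord_ge n f \<Longrightarrow> ord_ge n g \<Longrightarrow> ord_ge n (f + g)"
  "ord_ge n f \<Longrightarrow> ord_ge n g \<Longrightarrow> ord_ge n (f - g)" "ord_ge n f \<Longrightarrow> ord_ge n (- f)"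
  by (simp_all add: ord_ge_def)

lemma ord_ge_mono: "ord_ge n f \<Longrightarrow> m \<le> n \<Longrightarrow> ord_ge m f"
  by (simp add: ord_ge_def)

lemma ord_ge_shift: "ord_ge n f \<longleftrightarrow> f = fps_X ^ n * fps_shift n f"
  by (auto simp: ord_ge_def fps_eq_iff fps_X_power_mult_nth)

lemma ord_ge_mult_nth:
  assumes "ord_ge m f" "ord_ge n g"
  shows "fps_nth (f * g) (m + n) = fps_nth f m * fps_nth g n" "ord_ge (m + n) (f * g)"
proof -
  have "f * g = fps_X ^ (m + n) * (fps_shift m f * fps_shift n g)"
    using assms unfolding ord_ge_shift by (metis (no_types, lifting) mult.assoc mult.left_commute power_add)
  then show "fps_nth (f * g) (m + n) = fps_nth f m * fps_nth g n" "ord_ge (m + n) (f * g)"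
    by (simp_all add: fps_X_power_mult_nth ord_ge_def)
qed

lemma ord_ge_sq: "ord_ge n f \<Longrightarrow> ord_ge (2 * n) (sq f)"
  by (auto simp: ord_ge_def sq_nth elim!: evenE)

text \<open>On the ideal \<open>f = 0\<close>, a factor on the right whose \<open>f\<close> has order \<open>q\<close> acts on \<open>g\<close> through
  \<open>f(x\<^sup>2)\<close> and raises its order by \<open>2 q\<close>, whereas the same factor on the left would raise it by \<open>q\<close>
  only. This asymmetry is the obstruction to finite generation on the right.\<close>

lemma res_mult_growth:
  assumes "res_f A = 0" "ord_ge (2 * p) (res_g A)" "B \<in> carrier example_ring" "ord_ge q (res_f B)"
  shows "res_f (A ** B) = 0" "ord_ge (2 * (p + q)) (res_g (A ** B))"
proof -
  show "res_f (A ** B) = 0" using assms by (simp add: res_f_mult)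
  have "ord_ge (2 * p + 2 * q) (res_g A * sq (res_f B))"
    by (rule ord_ge_mult_nth) (use assms ord_ge_sq in auto)
  then show "ord_ge (2 * (p + q)) (res_g (A ** B))" using assms by (simp add: res_g_mult)
qed

definition E12 :: "'k::field mat2" where
  "E12 = mat2 0 1 0 0"

lemma E12_simps: "E12 \<in> carrier example_ring" "res_f E12 = 0" "res_g E12 = 1"
  by (simp_all add: E12_def carrier_example_ring res_f_def res_g_def sq_ring_hom)

lemma res_mult_E12: "res_f (A ** E12) = 0" "res_g (A ** E12) = res_f A"
  by (simp_all add: res_f_mult res_g_mult E12_simps sq_ring_hom)

section \<open>The Rees ring of the maximal ideal\<close>

text \<open>Negatives in a record are given by a definite description. Characterising them on \<open>H\<close> alone avoids
  showing first that the whole record is an abelian group.\<close>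

lemma additive_subgroupI_neg:
  assumes "H \<subseteq> carrier S" "\<zero>\<^bsub>S\<^esub> \<in> H" "\<And>x y. x \<in> H \<Longrightarrow> y \<in> H \<Longrightarrow> x \<oplus>\<^bsub>S\<^esub> y \<in> H"
    "\<And>x. x \<in> H \<Longrightarrow> neg x \<in> H"
    and uniq: "\<And>x z. x \<in> H \<Longrightarrow> z \<in> carrier S \<Longrightarrow> x \<oplus>\<^bsub>S\<^esub> z = \<zero>\<^bsub>S\<^esub> \<and> z \<oplus>\<^bsub>S\<^esub> x = \<zero>\<^bsub>S\<^esub> \<longleftrightarrow> z = neg x"
  shows "additive_subgroup H S"
proof
  fix x assume x: "x \<in> H"
  have "m_inv (add_monoid S) x = neg x"
    unfolding m_inv_def using uniq[OF x] assms(1) assms(4)[OF x]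
    by (intro the_equality) auto
  then show "m_inv (add_monoid S) x \<in> H" using assms(4)[OF x] by simp
qed (use assms in auto)

lemma sum_closed:
  fixes f :: "'i \<Rightarrow> 'b::comm_monoid_add"
  assumes "0 \<in> H" "\<And>x y. x \<in> H \<Longrightarrow> y \<in> H \<Longrightarrow> x + y \<in> H" "\<And>i. i \<in> I \<Longrightarrow> f i \<in> H"
  shows "(\<Sum>i\<in>I. f i) \<in> H"
  using assms(3) by (induction I rule: infinite_finite_induct) (use assms(1,2) in auto)

lemma ideal_power_mult:
  assumes A: "A \<in> ideal_power example_ring max_ideal m" and B: "B \<in> ideal_power example_ring max_ideal n"
  shows "A ** B \<in> ideal_power example_ring max_ideal (m + n)"
  using B
proof (induction n arbitrary: B)
  case 0
  then show ?case using ideal_example_ring(5)[OF ideal_ideal_power A] by simp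
next
  case (Suc n)
  from Suc.prems have "B \<in> ideal_power example_ring max_ideal n \<cdot>\<^bsub>example_ring\<^esub> max_ideal" by simp
  then show ?case
  proof (induction rule: ideal_prod.induct)
    case (prod C D)
    have "(A ** C) ** D \<in> ideal_power example_ring max_ideal (Suc (m + n))"
      using ideal_prod.prod[OF Suc.IH[OF prod(1)] prod(2), of example_ring] by simp
    then show ?case by (simp add: matrix_mul_assoc)
  next
    case (sum C D)
    then show ?case
      using ideal_example_ring(3)[OF ideal_ideal_power, of "A ** C" "m + Suc n" "A ** D"]
      by (simp add: mat2_mult_distrib)
  qed
qed

lemma ord_ge_res_f_ideal_power:
  "A \<in> ideal_power example_ring max_ideal n \<Longrightarrow> ord_ge n (res_f A)"
proof (induction n arbitrary: A)
  case (Suc n)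
  from Suc.prems have "A \<in> ideal_power example_ring max_ideal n \<cdot>\<^bsub>example_ring\<^esub> max_ideal" by simp
  then show ?case
  proof (induction rule: ideal_prod.induct)
    case (prod C D)
    have "ord_ge 1 (res_f D)" "D \<in> carrier example_ring" using prod(2) by (auto simp: max_ideal_def ord_ge_def)
    then show ?case using ord_ge_mult_nth(2)[OF Suc.IH[OF prod(1)], of 1] by (simp add: res_f_mult)
  qed (simp add: res_f_simps ord_ge_simps)
qed (simp add: ord_ge_simps)

abbreviation rees :: "('k::field mat2, nat \<Rightarrow> 'k mat2) up_ring" where
  "rees \<equiv> rees_ring example_ring max_ideal"

lemma up_example_ring_iff:
  "p \<in> up example_ring \<longleftrightarrow> (\<forall>n. p n \<in> carrier example_ring) \<and> (\<exists>N. \<forall>n>N. p n = 0)"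
  by (auto simp: up_def bound_def)

lemma carrier_rees:
  "p \<in> carrier rees \<longleftrightarrow> (\<forall>n. p n \<in> ideal_power example_ring max_ideal n) \<and> (\<exists>N. \<forall>n>N. p n = 0)"
  using ideal_example_ring(1)[OF ideal_ideal_power]
  by (fastforce simp: rees_ring_def UP_def up_example_ring_iff)

lemma carrier_rees_up: "p \<in> carrier rees \<Longrightarrow> p \<in> up example_ring"
  by (simp add: rees_ring_def UP_def)

lemma rees_simps:
  "\<zero>\<^bsub>rees\<^esub> = (\<lambda>n. 0)"
  "p \<in> carrier rees \<Longrightarrow> q \<in> carrier rees \<Longrightarrow> p \<oplus>\<^bsub>rees\<^esub> q = (\<lambda>n. p n + q n)"
  "p \<in> carrier rees \<Longrightarrow> q \<in> carrier rees \<Longrightarrow> p \<otimes>\<^bsub>rees\<^esub> q = (\<lambda>n. \<Sum>i\<le>n. p i ** q (n - i))"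
proof -
  show "\<zero>\<^bsub>rees\<^esub> = (\<lambda>n. 0)" by (simp add: rees_ring_def UP_def)
  assume pq: "p \<in> carrier rees" "q \<in> carrier rees"
  show "p \<oplus>\<^bsub>rees\<^esub> q = (\<lambda>n. p n + q n)"
    using pq[THEN carrier_rees_up] by (simp add: rees_ring_def UP_def)
  have "(\<Oplus>\<^bsub>example_ring\<^esub>i \<in> {..n}. p i ** q (n - i)) = (\<Sum>i\<le>n. p i ** q (n - i))" for n
    using pq[THEN carrier_rees_up]
    by (intro finsum_example_ring[THEN conjunct1]) (auto simp: up_example_ring_iff intro!: example_ring_closed)
  then show "p \<otimes>\<^bsub>rees\<^esub> q = (\<lambda>n. \<Sum>i\<le>n. p i ** q (n - i))"
    using pq[THEN carrier_rees_up] by (simp add: rees_ring_def UP_def)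
qed

lemma right_ideal_rees:
  assumes P0: "\<And>n. 0 \<in> P n" and Padd: "\<And>n A B. A \<in> P n \<Longrightarrow> B \<in> P n \<Longrightarrow> A + B \<in> P n"
    and Pneg: "\<And>n A. A \<in> P n \<Longrightarrow> - A \<in> P n"
    and Pmult: "\<And>m n A B. A \<in> P m \<Longrightarrow> B \<in> ideal_power example_ring max_ideal n \<Longrightarrow> A ** B \<in> P (m + n)"
  shows "right_ideal {p \<in> carrier rees. \<forall>n. p n \<in> P n} rees"
proof -
  note I = ideal_example_ring[OF ideal_ideal_power[where 'k = 'a]]
  have neg: "- A \<in> ideal_power example_ring max_ideal n" if "A \<in> ideal_power example_ring max_ideal n"
    for A :: "'a mat2" and n
    using I(4)[OF I(2) that] by simp
  have "additive_subgroup {p \<in> carrier rees. \<forall>n. p n \<in> P n} rees"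
  proof (rule additive_subgroupI_neg[where neg = "\<lambda>p n. - p n"])
    fix p q assume pq: "p \<in> {p \<in> carrier rees. \<forall>n. p n \<in> P n}" "q \<in> {p \<in> carrier rees. \<forall>n. p n \<in> P n}"
    then obtain M N where "\<forall>n>M. p n = 0" "\<forall>n>N. q n = 0" by (auto simp: carrier_rees)
    then have "\<exists>L. \<forall>n>L. p n + q n = 0" by (intro exI[of _ "max M N"]) auto
    then show "p \<oplus>\<^bsub>rees\<^esub> q \<in> {p \<in> carrier rees. \<forall>n. p n \<in> P n}"
      using pq I(3) Padd by (auto simp: rees_simps carrier_rees)
  next
    fix p assume p: "p \<in> {p \<in> carrier rees. \<forall>n. p n \<in> P n}"
    then obtain M where "\<forall>n>M. p n = 0" by (auto simp: carrier_rees)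
    then have "\<exists>L. \<forall>n>L. - p n = 0" by (intro exI[of _ M]) auto
    then show "(\<lambda>n. - p n) \<in> {p \<in> carrier rees. \<forall>n. p n \<in> P n}"
      using p neg Pneg by (auto simp: carrier_rees)
  next
    fix p z :: "nat \<Rightarrow> 'a mat2"
    assume p: "p \<in> {p \<in> carrier rees. \<forall>n. p n \<in> P n}" and z: "z \<in> carrier rees"
    then show "p \<oplus>\<^bsub>rees\<^esub> z = \<zero>\<^bsub>rees\<^esub> \<and> z \<oplus>\<^bsub>rees\<^esub> p = \<zero>\<^bsub>rees\<^esub> \<longleftrightarrow> z = (\<lambda>n. - p n)"
      by (auto simp: rees_simps fun_eq_iff add_eq_0_iff add_eq_0_iff2 minus_equation_iff)
    next
    show "{p \<in> carrier rees. \<forall>n. p n \<in> P n} \<subseteq> carrier rees" by blast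
    show "\<zero>\<^bsub>rees\<^esub> \<in> {p \<in> carrier rees. \<forall>n. p n \<in> P n}"
      using I(2) P0 by (simp add: rees_simps carrier_rees)
  qed
  moreover have "p \<otimes>\<^bsub>rees\<^esub> q \<in> {p \<in> carrier rees. \<forall>n. p n \<in> P n}"
    if p: "p \<in> {p \<in> carrier rees. \<forall>n. p n \<in> P n}" and q: "q \<in> carrier rees" for p q
  proof -
    have pc: "p \<in> carrier rees" using p by simp
    obtain M N where MN: "\<forall>n>M. p n = 0" "\<forall>n>N. q n = 0" using pc q by (auto simp: carrier_rees)
    have zero: "(\<Sum>i\<le>n. p i ** q (n - i)) = 0" if n: "n > M + N" for n
    proof (intro sum.neutral ballI)
      fix i assume "i \<in> {..n}"
      then have "i > M \<or> n - i > N" using n by auto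
      then show "p i ** q (n - i) = 0" using MN by auto
    qed
    have terms: "p i ** q (n - i) \<in> P n \<inter> ideal_power example_ring max_ideal n" if "i \<le> n" for i n
      using Pmult[of "p i" i "q (n - i)" "n - i"] ideal_power_mult[of "p i" i "q (n - i)" "n - i"] p q that
      by (simp add: carrier_rees)
    have "(\<Sum>i\<le>n. p i ** q (n - i)) \<in> P n \<inter> ideal_power example_ring max_ideal n" for n
      by (rule sum_closed) (use terms[of _ n] P0 Padd I(2,3) in auto)
    then show ?thesis using zero by (auto simp: rees_simps(3)[OF pc q] carrier_rees)
  qed
  ultimately show ?thesis by (auto simp: right_ideal_def)
qed

text \<open>The elements with \<open>f = 0\<close> in every degree form a right ideal. If its generators live in
  degrees at most \<open>D\<close>, then in degree \<open>n\<close> the order of \<open>g\<close> is at least \<open>2 (n - D)\<close>, whereas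
  \<open>x\<^sup>n E\<^sub>1\<^sub>2\<close> lies in the \<open>n\<close>-th power of the maximal ideal.\<close>

theorem not_strong_AR_example_ring:
  "\<not> strong_AR (example_ring :: ('k::field, 'k mat2) module) (jacobson_radical example_ring)"
proof
  let ?R = "example_ring :: ('k, 'k mat2) module"
  assume "strong_AR ?R (jacobson_radical ?R)"
  then have noeth: "right_noetherian (rees :: ('k mat2, nat \<Rightarrow> 'k mat2) up_ring)"
    by (simp add: strong_AR_def noetherian_def jacobson_radical_example_ring)
  note I = ideal_example_ring[OF ideal_ideal_power[where 'k = 'k]]
  define P :: "nat \<Rightarrow> nat \<Rightarrow> 'k mat2 set" where
    "P D n = {A. res_f A = 0 \<and> ord_ge (2 * (n - D)) (res_g A)}" for D n
  define N :: "'k mat2 set" where "N = {A. res_f A = 0}"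
  have rP: "right_ideal {p \<in> carrier rees. \<forall>n. p n \<in> P D n} rees" for D
  proof (rule right_ideal_rees)
    fix m n A B assume A: "A \<in> P D m" and B: "B \<in> ideal_power ?R max_ideal n"
    have "res_f (A ** B) = 0" "ord_ge (2 * ((m - D) + n)) (res_g (A ** B))"
      using res_mult_growth[of A "m - D" B n] ord_ge_res_f_ideal_power[OF B] A B I(1)
      by (auto simp: P_def)
    then show "A ** B \<in> P D (m + n)" by (auto simp: P_def intro: ord_ge_mono)
  qed (auto simp: P_def res_f_simps res_g_simps ord_ge_simps)
  have rN: "right_ideal {p \<in> carrier rees. \<forall>n. p n \<in> N} rees"
    by (rule right_ideal_rees) (auto simp: N_def res_f_simps res_f_mult[OF subsetD[OF I(1)]])
  obtain A where A: "A \<subseteq> carrier rees" "finite A"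
    and gen: "{p \<in> carrier rees. \<forall>n. p n \<in> N} = \<Inter>{J. right_ideal J rees \<and> A \<subseteq> J}"
    using noeth[unfolded right_noetherian_def, rule_format, OF rN] by blast
  have "\<forall>p\<in>A. \<exists>d. \<forall>n>d. p n = 0" using A(1) by (auto simp: carrier_rees)
  then obtain dg where dg: "\<And>p n. p \<in> A \<Longrightarrow> n > dg p \<Longrightarrow> p n = 0" by metis
  obtain D where D: "\<And>p. p \<in> A \<Longrightarrow> dg p \<le> D"
    using finite_nat_set_iff_bounded_le[of "dg ` A"] A(2) by auto
  have "A \<subseteq> {p \<in> carrier rees. \<forall>n. p n \<in> N}" unfolding gen by blast
  then have "A \<subseteq> {p \<in> carrier rees. \<forall>n. p n \<in> P D n}"
  proof -
    assume sub: "A \<subseteq> {p \<in> carrier rees. \<forall>n. p n \<in> N}"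
    have "p n \<in> P D n" if "p \<in> A" for p n
    proof (cases "n \<le> D")
      case True
      then show ?thesis using sub that by (auto simp: P_def N_def ord_ge_simps)
    next
      case False
      then have "p n = 0" using dg[OF that, of n] D[OF that] by simp
      then show ?thesis by (simp add: P_def res_f_simps res_g_simps ord_ge_simps)
    qed
    then show ?thesis using A(1) by blast
  qed
  then have le: "{p \<in> carrier rees. \<forall>n. p n \<in> N} \<subseteq> {p \<in> carrier rees. \<forall>n. p n \<in> P D n}"
    unfolding gen using rP by blast
  define n where "n = 2 * D + 1"
  define p :: "nat \<Rightarrow> 'k mat2" where "p j = (if j = n then tau (xS ^ n) ** E12 else 0)" for j
  have "tau (xS ^ n) ** E12 \<in> ideal_power ?R max_ideal n"
    by (intro I(5) tau_power_in_ideal_power E12_simps) simp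
  then have "p \<in> {p \<in> carrier rees. \<forall>n. p n \<in> N}"
    using I(2) by (auto simp: p_def carrier_rees N_def res_mult_E12 res_f_simps)
  then have "p n \<in> P D n" using le by blast
  then have "ord_ge (2 * (n - D)) (res_f (tau (xS ^ n)) :: 'k fps)"
    by (simp add: P_def p_def res_mult_E12)
  moreover have "n < 2 * (n - D)" by (simp add: n_def)
  ultimately have "fps_nth (res_f (tau (xS ^ n) :: 'k mat2)) n = 0" unfolding ord_ge_def by blast
  then show False by (simp add: res_f_tau)
qed

section \<open>Weak adic filtrations\<close>

lemma (in vector_space) sequence_dependent:
  fixes u :: "nat \<Rightarrow> 'b"
  assumes "finite B" "\<And>t. u t \<in> span B"
  shows "\<exists>T c. finite T \<and> (\<exists>t\<in>T. c t \<noteq> 0) \<and> (\<Sum>t\<in>T. scale (c t) (u t)) = 0"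
proof (cases "inj u")
  case True
  have "dependent (range u)"
  proof (rule ccontr)
    assume "independent (range u)"
    then have "finite (range u)" using independent_span_bound[OF assms(1)] assms(2) by blast
    then show False using True finite_imageD by blast
  qed
  then obtain S c where S: "finite S" "S \<subseteq> range u" "(\<Sum>v\<in>S. scale (c v) v) = 0" "\<exists>v\<in>S. c v \<noteq> 0"
    unfolding dependent_explicit by blast
  have "(\<Sum>t\<in>u -` S. scale (c (u t)) (u t)) = (\<Sum>v\<in>u ` (u -` S). scale (c v) v)"
    by (subst sum.reindex) (use True in \<open>auto simp: inj_on_def inj_def\<close>)
  also have "u ` (u -` S) = S" using S(2) by auto
  finally have "(\<Sum>t\<in>u -` S. scale (c (u t)) (u t)) = 0" using S(3) by simp
  moreover have "finite (u -` S)" using S(1) True by (rule finite_vimageI)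
  moreover have "\<exists>t\<in>u -` S. c (u t) \<noteq> 0" using S(2,4) by fastforce
  ultimately show ?thesis by (intro exI[of _ "u -` S"] exI[of _ "\<lambda>t. c (u t)"]) blast
next
  case False
  then obtain s t where st: "s \<noteq> t" "u s = u t" by (auto simp: inj_def)
  then have "(\<Sum>r\<in>{s, t}. scale ((\<lambda>r. if r = s then 1 else - 1) r) (u r)) = 0" by simp
  then show ?thesis
    by (intro exI[of _ "{s, t}"] exI[of _ "\<lambda>r. if r = s then 1 else - 1"]) auto
qed

definition cscale :: "'k::field \<Rightarrow> 'k mat2 \<Rightarrow> 'k mat2" where
  "cscale c A = (\<chi> i j. fps_const (fps_const c) * A $ i $ j)"

lemma vector_space_cscale: "vector_space cscale"
  by unfold_locales
    (simp_all add: cscale_def vec_eq_iff algebra_simps flip: fps_const_add fps_const_mult)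

lemma cscale_tau: "cscale c (tau h) = tau (fps_const (fps_const c) * h)"
  by (rule mat2_eqI) (simp_all add: cscale_def tau_def sqx_ring_hom sqx_const sq_ring_hom)

lemma coef_cscale: "coef (cscale c A) i j a b = c * coef A i j a b"
  by (simp add: coef_def cscale_def)

lemma finite_wt_less: "finite {(i, j, a, b). wt i j a b < c}"
proof (rule finite_subset)
  show "{(i, j, a, b). wt i j a b < c} \<subseteq> UNIV \<times> UNIV \<times> {..nat (c + 1)} \<times> {..nat (c + 1)}"
    by (auto simp: wt_def split: if_splits)
qed simp

locale weak_adic =
  fixes \<Gamma> :: "int \<Rightarrow> 'k::field mat2 set"
  assumes weak_adic: "weak_adic_filtration ring_of_type_algebra example_ring \<Gamma>"
begin

abbreviation "R \<equiv> example_ring :: ('k, 'k mat2) module"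

lemma filtration: "filtration ring_of_type_algebra R \<Gamma>"
  using weak_adic by (simp add: weak_adic_filtration_def)

lemma \<Gamma>_submodule: "submodule (\<Gamma> i) ring_of_type_algebra R"
  using filtration by (simp add: filtration_def)

lemma \<Gamma>_additive_subgroup: "additive_subgroup (\<Gamma> i) R"
  using \<Gamma>_submodule[of i] by (simp add: submodule_def additive_subgroup_def)

lemmas \<Gamma>_closed = additive_subgroup_example_ring[OF \<Gamma>_additive_subgroup]

lemma \<Gamma>_cscale: "A \<in> \<Gamma> i \<Longrightarrow> cscale c A \<in> \<Gamma> i"
  using submodule.smult_closed[OF \<Gamma>_submodule, of c A i] by (simp add: cscale_def)

lemma \<Gamma>_mult: "A \<in> \<Gamma> i \<Longrightarrow> B \<in> \<Gamma> j \<Longrightarrow> A ** B \<in> \<Gamma> (i + j)"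
  using filtration unfolding filtration_def by simp

lemma \<Gamma>_nonneg: "i \<ge> 0 \<Longrightarrow> \<Gamma> i = carrier R"
  using weak_adic by (simp add: weak_adic_filtration_def)

lemma \<Gamma>_mult_carrier:
  "A \<in> \<Gamma> i \<Longrightarrow> B \<in> carrier R \<Longrightarrow> A ** B \<in> \<Gamma> i" "A \<in> \<Gamma> i \<Longrightarrow> B \<in> carrier R \<Longrightarrow> B ** A \<in> \<Gamma> i"
  using \<Gamma>_mult[of A i B 0] \<Gamma>_mult[of B 0 A i] by (simp_all add: \<Gamma>_nonneg)

lemma \<Gamma>_mono:
  assumes "i \<le> j" shows "\<Gamma> i \<subseteq> \<Gamma> j"
  using assms
proof (induction rule: int_ge_induct)
  case (step j)
  have "\<Gamma> j \<subseteq> \<Gamma> (j + 1)" using filtration by (simp add: filtration_def)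
  with step show ?case by blast
qed simp

lemma \<Gamma>_separated: "(\<And>i. A \<in> \<Gamma> i) \<Longrightarrow> A = 0"
  using filtration unfolding filtration_def by auto

lemma \<Gamma>_ideal: "ideal (\<Gamma> i) R"
  by (intro idealI ring_example_ring)
    (use \<Gamma>_additive_subgroup[of i] \<Gamma>_mult_carrier in \<open>auto simp: additive_subgroup_def\<close>)

text \<open>A quotient of finite dimension satisfies a linear relation between the powers of a topologically
  nilpotent element. The lowest power in such a relation is a unit multiple of the whole relation.\<close>

lemma tau_power_in_\<Gamma>_step:
  assumes h: "fps_nth (fps_nth h 0) 0 = 0" and n: "tau (h ^ n) \<in> \<Gamma> i"
  shows "\<exists>m. tau (h ^ m) \<in> \<Gamma> (i - 1)"
proof -
  interpret V: vector_space "cscale :: 'k \<Rightarrow> 'k mat2 \<Rightarrow> 'k mat2" by (rule vector_space_cscale)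
  define v where "v t = tau (h ^ (n + t))" for t
  have v: "v t \<in> \<Gamma> i" for t
    using \<Gamma>_mult_carrier(1)[OF n tau_in_carrier] by (simp add: v_def power_add tau_simps)
  have "finite_dim_quotient ring_of_type_algebra R (\<Gamma> i) (\<Gamma> (i - 1))"
    using filtration by (simp add: filtration_def)
  then obtain B where B: "B \<subseteq> \<Gamma> i" "finite B"
    and span: "\<And>A. A \<in> \<Gamma> i \<Longrightarrow> \<exists>c\<in>B \<rightarrow> carrier ring_of_type_algebra.
      A \<in> \<Gamma> (i - 1) +>\<^bsub>R\<^esub> (\<Oplus>\<^bsub>R\<^esub>b\<in>B. c b \<odot>\<^bsub>R\<^esub> b)"
    unfolding finite_dim_quotient_def by blast
  have "\<exists>w. w \<in> \<Gamma> (i - 1) \<and> v t - w \<in> V.span B" for t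
  proof -
    obtain c where c: "v t \<in> \<Gamma> (i - 1) +>\<^bsub>R\<^esub> (\<Oplus>\<^bsub>R\<^esub>b\<in>B. c b \<odot>\<^bsub>R\<^esub> b)" using span[OF v] by blast
    have "(\<Oplus>\<^bsub>R\<^esub>b\<in>B. c b \<odot>\<^bsub>R\<^esub> b) = (\<Sum>b\<in>B. cscale (c b) b)"
      unfolding cscale_def example_ring_simps
      by (rule finsum_example_ring[THEN conjunct1])
        (use B \<Gamma>_cscale[of _ i] \<Gamma>_closed(1)[of i] in \<open>auto simp: cscale_def\<close>)
    then obtain w where "w \<in> \<Gamma> (i - 1)" "v t = w + (\<Sum>b\<in>B. cscale (c b) b)"
      using c by (auto simp: a_r_coset_def' )
    moreover have "(\<Sum>b\<in>B. cscale (c b) b) \<in> V.span B"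
      by (intro V.span_sum V.span_scale V.span_base)
    ultimately show ?thesis by (intro exI[of _ w]) simp
  qed
  then obtain w where w: "\<And>t. w t \<in> \<Gamma> (i - 1)" "\<And>t. v t - w t \<in> V.span B" by metis
  obtain T c where T: "finite T" "\<exists>t\<in>T. c t \<noteq> 0" "(\<Sum>t\<in>T. cscale (c t) (v t - w t)) = 0"
    using V.sequence_dependent[of B "\<lambda>t. v t - w t", OF B(2) w(2)] by blast
  have "(\<Sum>t\<in>T. cscale (c t) (v t)) = (\<Sum>t\<in>T. cscale (c t) (w t))"
    using T(3) by (simp add: V.scale_right_diff_distrib sum_subtractf)
  also have "\<dots> \<in> \<Gamma> (i - 1)"
    by (rule sum_closed) (use \<Gamma>_closed w(1) \<Gamma>_cscale in auto)
  finally have rel: "(\<Sum>t\<in>T. cscale (c t) (v t)) \<in> \<Gamma> (i - 1)" .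
  define S where "S = {t \<in> T. c t \<noteq> 0}"
  have S: "finite S" "S \<noteq> {}" using T(1,2) by (auto simp: S_def)
  define t0 where "t0 = Min S"
  have t0: "t0 \<in> S" "\<And>t. t \<in> S \<Longrightarrow> t0 \<le> t" using S by (simp_all add: t0_def)
  define e where "e = (\<Sum>t\<in>S. fps_const (fps_const (c t)) * h ^ (t - t0))"
  have "fps_nth (fps_nth (fps_const (fps_const (c t)) * h ^ (t - t0)) 0) 0 = (if t = t0 then c t0 else 0)"
    if "t \<in> S" for t
  proof (cases "t = t0")
    case False
    then have "t - t0 \<noteq> 0" using t0(2)[OF that] by simp
    then show ?thesis using h False by (simp add: fps_nth_power_0 power_0_left)
  qed simp
  then have "fps_nth (fps_nth e 0) 0 = (\<Sum>t\<in>S. if t = t0 then c t0 else 0)"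
    unfolding e_def fps_sum_nth by (intro sum.cong refl)
  also have "\<dots> = c t0" using S(1) t0(1) by simp
  finally have "fps_nth (fps_nth e 0) 0 \<noteq> 0" using t0(1) by (simp add: S_def)
  then obtain e' where e': "e * e' = 1" using fps_fps_unit by blast
  have "(\<Sum>t\<in>T. cscale (c t) (v t)) = (\<Sum>t\<in>S. cscale (c t) (v t))"
    using T(1) by (intro sum.mono_neutral_right) (auto simp: S_def)
  also have "\<dots> = tau (\<Sum>t\<in>S. fps_const (fps_const (c t)) * h ^ (n + t))"
    by (simp add: v_def cscale_tau tau_sum)
  also have "(\<Sum>t\<in>S. fps_const (fps_const (c t)) * h ^ (n + t)) = h ^ (n + t0) * e"
  proof -
    have "h ^ (n + t) = h ^ (n + t0) * h ^ (t - t0)" if "t \<in> S" for t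
      using t0(2)[OF that] by (simp flip: power_add)
    then show ?thesis by (simp add: e_def sum_distrib_left mult_ac)
  qed
  finally have "tau (h ^ (n + t0) * e) \<in> \<Gamma> (i - 1)" using rel by simp
  then have "tau (h ^ (n + t0) * e) ** tau e' \<in> \<Gamma> (i - 1)"
    by (rule \<Gamma>_mult_carrier) (rule tau_in_carrier)
  also have "tau (h ^ (n + t0) * e) ** tau e' = tau (h ^ (n + t0) * (e * e'))"
    by (simp only: tau_simps(2) matrix_mul_assoc)
  finally show ?thesis using e' by auto
qed

lemma tau_power_in_\<Gamma>:
  assumes h: "fps_nth (fps_nth h 0) 0 = 0"
  shows "\<exists>n. tau (h ^ n) \<in> \<Gamma> i"
proof -
  have "\<exists>n. tau (h ^ n) \<in> \<Gamma> (- int k)" for k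
  proof (induction k)
    case 0
    then show ?case using tau_in_carrier by (auto simp: \<Gamma>_nonneg)
  next
    case (Suc k)
    then obtain n where "tau (h ^ n) \<in> \<Gamma> (- int k)" by blast
    moreover have "- int (Suc k) = - int k - 1" by simp
    ultimately show ?case using tau_power_in_\<Gamma>_step[OF h] by metis
  qed
  then obtain n where "tau (h ^ n) \<in> \<Gamma> (- int (nat (- i)))" by blast
  moreover have "- int (nat (- i)) \<le> i" by simp
  ultimately show ?thesis using \<Gamma>_mono by blast
qed

text \<open>Every step of the filtration is an ideal containing powers of \<open>tau x\<close> and \<open>tau y\<close>, hence open.\<close>

lemma W_subset_\<Gamma>: "\<exists>c. carrier R \<inter> W c \<subseteq> \<Gamma> i"
proof -
  obtain m n where mn: "tau (xS ^ m) \<in> \<Gamma> i" "tau (fps_X ^ n) \<in> \<Gamma> i"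
  proof -
    have "fps_nth (fps_nth xS 0) 0 = 0" "fps_nth (fps_nth fps_X 0) 0 = 0" by simp_all
    then show ?thesis using tau_power_in_\<Gamma> that by blast
  qed
  have "tau (xS ^ m) ** tau (xS ^ n) \<in> \<Gamma> i" "tau (fps_X ^ n) ** tau (fps_X ^ m) \<in> \<Gamma> i"
    using mn by (auto intro: \<Gamma>_mult_carrier tau_in_carrier)
  then have "tau (xS ^ (m + n)) \<in> \<Gamma> i" "tau (fps_X ^ (m + n)) \<in> \<Gamma> i"
    by (simp_all add: power_add tau_simps mult.commute flip: tau_simps(2))
  then show ?thesis using ideal_W_subset[OF \<Gamma>_ideal] by blast
qed

text \<open>Chevalley's theorem for this ring: otherwise some coefficient of low weight takes the value one
  at some element of every step of the filtration, and linear compactness produces a nonzero element of the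
  intersection.\<close>

lemma \<Gamma>_subset_W: "\<exists>i. \<Gamma> i \<subseteq> W c"
proof (rule ccontr)
  assume no: "\<nexists>i. \<Gamma> i \<subseteq> W c"
  define cf :: "'k mat2 \<Rightarrow> 2 \<times> 2 \<times> nat \<times> nat \<Rightarrow> 'k" where
    "cf A = (\<lambda>(i, j, a, b). coef A i j a b)" for A
  define S where "S d = {(i :: 2, j :: 2, a :: nat, b :: nat). wt i j a b < d}" for d
  have Sfin: "finite (S d)" for d unfolding S_def by (rule finite_wt_less)
  have WS: "A \<in> W d \<longleftrightarrow> (\<forall>q\<in>S d. cf A q = 0)" for A d by (auto simp: W_def S_def cf_def)
  have "\<exists>q\<in>S c. \<exists>A\<in>\<Gamma> (- int n). cf A q \<noteq> 0" for n using no WS by blast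
  then obtain q where q: "\<And>n. q n \<in> S c" "\<And>n. \<exists>A\<in>\<Gamma> (- int n). cf A (q n) \<noteq> 0" by metis
  have "finite (range q)" using q(1) by (intro finite_subset[OF _ Sfin]) auto
  then obtain n0 where "infinite {n \<in> UNIV. q n = q n0}"
    using pigeonhole_infinite[of UNIV q] by auto
  then have inf: "\<exists>m>n. q m = q n0" for n
    using infinite_nat_iff_unbounded[of "{n \<in> UNIV. q n = q n0}"] by auto
  define p where "p = q n0"
  have ne: "\<exists>A\<in>\<Gamma> (- int n). cf A p = 1" for n
  proof -
    obtain m where m: "m > n" "q m = p" using inf p_def by blast
    obtain A where A: "A \<in> \<Gamma> (- int m)" "cf A p \<noteq> 0" using q(2)[of m] m(2) by auto
    have "A \<in> \<Gamma> (- int n)" using A(1) \<Gamma>_mono[of "- int m" "- int n"] m(1) by auto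
    then have "cscale (1 / cf A p) A \<in> \<Gamma> (- int n)" by (rule \<Gamma>_cscale)
    moreover have "cf (cscale (1 / cf A p) A) p = 1"
      using A(2) by (cases p) (simp add: cf_def coef_cscale)
    ultimately show ?thesis by blast
  qed
  have "countable (UNIV :: (2 \<times> 2 \<times> nat \<times> nat) set)"
    unfolding UNIV_Times_UNIV[symmetric] by (intro countable_SIGMA) (auto intro: countable_finite)
  then obtain en :: "nat \<Rightarrow> 2 \<times> 2 \<times> nat \<times> nat" where en: "range en = UNIV"
    by (metis UNIV_not_empty range_from_nat_into)
  define g where "g = inv_into UNIV en"
  have g: "en (g r) = r" for r using en unfolding g_def by (simp add: surj_f_inv_f)
  define C where "C n = (\<lambda>A j. cf A (en j)) ` {A \<in> \<Gamma> (- int n). cf A p = 1}" for n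
  have "\<exists>z. \<forall>n j. \<exists>u\<in>C n. \<forall>i<j. u i = z i"
  proof (rule linear_compactness)
    show "C n \<subseteq> C m" if "m \<le> n" for m n
      using that \<Gamma>_mono[of "- int n" "- int m"] by (auto simp: C_def)
    show "C n \<noteq> {}" for n using ne[of n] by (auto simp: C_def)
    fix n u v and a :: 'k assume "u \<in> C n" "v \<in> C n"
    then obtain A B where A: "A \<in> \<Gamma> (- int n)" "cf A p = 1" "u = (\<lambda>j. cf A (en j))"
      and B: "B \<in> \<Gamma> (- int n)" "cf B p = 1" "v = (\<lambda>j. cf B (en j))" by (auto simp: C_def)
    define D where "D = cscale a A + cscale (1 - a) B"
    have D: "cf D r = a * cf A r + (1 - a) * cf B r" for r
      by (cases r) (simp add: D_def cf_def coef_simps coef_cscale)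
    moreover have "D \<in> \<Gamma> (- int n)" unfolding D_def using A(1) B(1) by (intro \<Gamma>_closed(3) \<Gamma>_cscale)
    ultimately show "(\<lambda>j. a * u j + (1 - a) * v j) \<in> C n"
      using A B unfolding C_def by (intro image_eqI[of _ _ D]) auto
  qed
  then obtain z where z: "\<And>n j. \<exists>u\<in>C n. \<forall>i<j. u i = z i" by blast
  define l :: "'k mat2" where "l = (\<chi> i j. Abs_fps (\<lambda>b. Abs_fps (\<lambda>a. z (g (i, j, a, b)))))"
  have l: "cf l r = z (g r)" for r by (cases r) (simp add: cf_def l_def coef_def)
  have approx: "\<exists>A\<in>\<Gamma> (- int n). A - l \<in> W d \<and> cf A p = 1 \<and> cf l p = 1" for n d
  proof -
    obtain N where N: "\<And>r. r \<in> insert p (S d) \<Longrightarrow> g r < N"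
      using finite_nat_set_iff_bounded[of "g ` insert p (S d)"] Sfin[of d] by auto
    obtain u where u: "u \<in> C n" "\<forall>i<N. u i = z i" using z by blast
    then obtain A where A: "A \<in> \<Gamma> (- int n)" "cf A p = 1" "u = (\<lambda>j. cf A (en j))" by (auto simp: C_def)
    have "cf A r = cf l r" if "r \<in> insert p (S d)" for r
    proof -
      have "u (g r) = z (g r)" using u(2) N[OF that] by blast
      then show ?thesis by (simp add: l A(3) g)
    qed
    then have eq: "\<And>r. r \<in> S d \<Longrightarrow> cf A r = cf l r" "cf A p = cf l p" by auto
    have "cf (A - l) r = cf A r - cf l r" for r by (cases r) (simp add: cf_def coef_simps)
    then have "A - l \<in> W d" using eq(1) by (simp add: WS)
    then show ?thesis using A eq(2) by auto
  qed
  have lR: "l \<in> carrier R"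
    by (rule carrier_closed) (use approx[of 0] in \<open>auto simp: \<Gamma>_nonneg\<close>)
  have "l \<in> \<Gamma> i" for i
  proof -
    obtain d where d: "carrier R \<inter> W d \<subseteq> \<Gamma> i" using W_subset_\<Gamma> by blast
    obtain A where A: "A \<in> \<Gamma> (- int (nat (- i)))" "A - l \<in> W d" using approx by blast
    have "- int (nat (- i)) \<le> i" by simp
    then have Ai: "A \<in> \<Gamma> i" using A(1) \<Gamma>_mono by blast
    have "A - l \<in> carrier R" using Ai \<Gamma>_closed(1) lR example_ring_closed(2) by blast
    then have "A - (A - l) \<in> \<Gamma> i" using d A(2) Ai \<Gamma>_closed(5) by blast
    then show ?thesis by simp
  qed
  then have "l = 0" by (rule \<Gamma>_separated)
  moreover have "cf l p = 1" using approx by blast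
  ultimately show False by (cases p) (simp add: cf_def coef_simps)
qed

end

section \<open>Right ideals of the associated graded ring\<close>

context weak_adic
begin

abbreviation "gr \<equiv> assoc_graded R \<Gamma>"

definition gcoset :: "int \<Rightarrow> 'k mat2 \<Rightarrow> 'k mat2 set" where
  "gcoset i A = \<Gamma> (i - 1) +>\<^bsub>R\<^esub> A"

lemma gcoset_iff: "B \<in> gcoset i A \<longleftrightarrow> B - A \<in> \<Gamma> (i - 1)"
proof -
  have "B \<in> gcoset i A \<longleftrightarrow> (\<exists>h\<in>\<Gamma> (i - 1). B = h + A)" by (simp add: gcoset_def a_r_coset_def')
  also have "\<dots> \<longleftrightarrow> B - A \<in> \<Gamma> (i - 1)" by (metis add_diff_cancel_right' diff_add_cancel)
  finally show ?thesis .
qed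

lemma gcoset_eq_iff: "gcoset i A = gcoset i B \<longleftrightarrow> A - B \<in> \<Gamma> (i - 1)"
proof
  assume "gcoset i A = gcoset i B"
  moreover have "A \<in> gcoset i A" by (simp add: gcoset_iff \<Gamma>_closed)
  ultimately show "A - B \<in> \<Gamma> (i - 1)" by (simp add: gcoset_iff)
next
  assume AB: "A - B \<in> \<Gamma> (i - 1)"
  have "C - A \<in> \<Gamma> (i - 1) \<longleftrightarrow> C - B \<in> \<Gamma> (i - 1)" for C
    using \<Gamma>_closed(3)[OF _ AB, of "C - A"] \<Gamma>_closed(5)[OF _ AB, of "C - B"] by auto
  then show "gcoset i A = gcoset i B" by (auto simp: gcoset_iff)
qed

lemma gcoset_0: "gcoset i 0 = \<Gamma> (i - 1)"
  by (auto simp: gcoset_iff)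

lemma abelian_subgroup_\<Gamma>: "abelian_subgroup (\<Gamma> i) R"
  by (intro abelian_subgroupI3 \<Gamma>_additive_subgroup ring.is_abelian_group ring_example_ring)

lemma gcoset_add: "A \<in> carrier R \<Longrightarrow> B \<in> carrier R \<Longrightarrow> gcoset i A <+>\<^bsub>R\<^esub> gcoset i B = gcoset i (A + B)"
  using abelian_subgroup.a_rcos_sum[OF abelian_subgroup_\<Gamma>] by (simp add: gcoset_def)

lemma gcoset_mult:
  assumes "A \<in> \<Gamma> i" "B \<in> \<Gamma> j"
  shows "rcoset_mult R (\<Gamma> (i + j - 1)) (gcoset i A) (gcoset j B) = gcoset (i + j) (A ** B)"
proof -
  have "\<Gamma> (i + j - 1) +>\<^bsub>R\<^esub> (C \<otimes>\<^bsub>R\<^esub> D) = gcoset (i + j) (A ** B)" if "C \<in> gcoset i A" "D \<in> gcoset j B" for C D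
  proof -
    have CA: "C - A \<in> \<Gamma> (i - 1)" "D - B \<in> \<Gamma> (j - 1)" using that by (simp_all add: gcoset_iff)
    have "D = B + (D - B)" by simp
    also have "\<dots> \<in> \<Gamma> j" using assms(2) CA(2) \<Gamma>_mono[of "j - 1" j] \<Gamma>_closed(3) by fastforce
    finally have "(C - A) ** D \<in> \<Gamma> (i - 1 + j)" using CA(1) by (rule \<Gamma>_mult[rotated])
    moreover have "A ** (D - B) \<in> \<Gamma> (i + (j - 1))" using assms(1) CA(2) by (rule \<Gamma>_mult)
    ultimately have "(C - A) ** D + A ** (D - B) \<in> \<Gamma> (i + j - 1)"
      by (intro \<Gamma>_closed(3)) (simp_all add: algebra_simps)
    then have "C ** D - A ** B \<in> \<Gamma> (i + j - 1)" by (simp add: mat2_mult_distrib)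
    then show ?thesis using gcoset_eq_iff[of "i + j" "C ** D" "A ** B"] by (simp add: gcoset_def)
  qed
  moreover have "A \<in> gcoset i A" "B \<in> gcoset j B" by (simp_all add: gcoset_iff \<Gamma>_closed)
  ultimately show ?thesis unfolding rcoset_mult_def by blast
qed

lemma gcoset_finprod:
  assumes "finite I" "\<And>i. i \<in> I \<Longrightarrow> C i \<in> carrier R" "\<And>i. i \<in> I \<Longrightarrow> f i = gcoset n (C i)"
  shows "finprod (R A_Mod \<Gamma> (n - 1)) f I = gcoset n (\<Sum>i\<in>I. C i)"
proof -
  interpret H: abelian_subgroup "\<Gamma> (n - 1)" R by (rule abelian_subgroup_\<Gamma>)
  interpret Q: comm_group "R A_Mod \<Gamma> (n - 1)" by (rule H.a_factorgroup_is_comm_group)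
  have car: "gcoset n A \<in> carrier (R A_Mod \<Gamma> (n - 1))" if "A \<in> carrier R" for A
    using that unfolding A_FactGroup_def' A_RCOSETS_def' gcoset_def by auto
  show ?thesis using assms
  proof (induction I rule: finite_induct)
    case empty
    have "\<one>\<^bsub>R A_Mod \<Gamma> (n - 1)\<^esub> = \<Gamma> (n - 1)" by (simp add: A_FactGroup_def')
    then show ?case by (simp add: gcoset_0)
  next
    case (insert i I)
    have "finprod (R A_Mod \<Gamma> (n - 1)) f I = gcoset n (\<Sum>i\<in>I. C i)"
      by (rule insert.IH) (use insert.prems in auto)
    moreover have "(\<Sum>i\<in>I. C i) \<in> carrier R"
      by (rule sum_closed) (use example_ring_01(1) example_ring_closed(1) insert.prems(1) in auto)
    ultimately show ?case using insert.hyps insert.prems car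
      by (subst Q.finprod_insert) (auto simp: gcoset_add)
  qed
qed

lemma carrier_gr:
  "\<phi> \<in> carrier gr \<longleftrightarrow> (\<forall>i. \<exists>A\<in>\<Gamma> i. \<phi> i = gcoset i A) \<and> finite {i. \<phi> i \<noteq> \<Gamma> (i - 1)}"
  by (auto simp: assoc_graded_def gcoset_def image_iff)

lemma gr_simps:
  "\<zero>\<^bsub>gr\<^esub> = (\<lambda>i. \<Gamma> (i - 1))" "\<phi> \<oplus>\<^bsub>gr\<^esub> \<psi> = (\<lambda>i. \<phi> i <+>\<^bsub>R\<^esub> \<psi> i)"
  by (simp_all add: assoc_graded_def)

text \<open>Choosing \<open>0\<close> in every trivial component makes the product of two families of representatives vanish
  outside a finite set of degrees.\<close>

definition reps :: "(int \<Rightarrow> 'k mat2) \<Rightarrow> (int \<Rightarrow> 'k mat2 set) \<Rightarrow> bool" where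
  "reps A \<phi> \<longleftrightarrow> (\<forall>i. A i \<in> \<Gamma> i \<and> \<phi> i = gcoset i (A i) \<and> (\<phi> i = \<Gamma> (i - 1) \<longrightarrow> A i = 0))"

lemma gr_mult:
  assumes A: "reps A \<phi>" and B: "reps B \<psi>" and fin: "finite {i. \<phi> i \<noteq> \<Gamma> (i - 1)}"
  shows "(\<phi> \<otimes>\<^bsub>gr\<^esub> \<psi>) n = gcoset n (\<Sum>i | \<phi> i \<noteq> \<Gamma> (i - 1). A i ** B (n - i))"
proof -
  have "rcoset_mult R (\<Gamma> (n - 1)) (\<phi> i) (\<psi> (n - i)) = gcoset n (A i ** B (n - i))" for i
    using gcoset_mult[of "A i" i "B (n - i)" "n - i"] A B by (simp add: reps_def)
  moreover have "A i ** B (n - i) \<in> carrier R" for i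
    using A B \<Gamma>_closed(1) unfolding reps_def by (intro example_ring_closed) blast+
  ultimately have "finprod (R A_Mod \<Gamma> (n - 1))
      (\<lambda>i. rcoset_mult R (\<Gamma> (n - 1)) (\<phi> i) (\<psi> (n - i))) {i. \<phi> i \<noteq> \<Gamma> (i - 1)}
      = gcoset n (\<Sum>i | \<phi> i \<noteq> \<Gamma> (i - 1). A i ** B (n - i))"
    using fin by (intro gcoset_finprod) auto
  then show ?thesis by (simp add: assoc_graded_def)
qed

definition gr_part :: "(int \<Rightarrow> 'k mat2 set) \<Rightarrow> (int \<Rightarrow> 'k mat2 set) set" where
  "gr_part P = {\<phi> \<in> carrier gr. \<forall>i. \<exists>A\<in>P i. \<phi> i = gcoset i A}"

lemma right_ideal_gr_part:
  assumes sub: "\<And>i. P i \<subseteq> \<Gamma> i" and P0: "\<And>i. 0 \<in> P i"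
    and Padd: "\<And>i A B. A \<in> P i \<Longrightarrow> B \<in> P i \<Longrightarrow> A + B \<in> P i" and Pneg: "\<And>i A. A \<in> P i \<Longrightarrow> - A \<in> P i"
    and Pmult: "\<And>i j A B. A \<in> P i \<Longrightarrow> B \<in> \<Gamma> j \<Longrightarrow> A ** B \<in> P (i + j)"
  shows "right_ideal (gr_part P) gr"
proof -
  have \<Gamma>R: "A \<in> \<Gamma> i \<Longrightarrow> A \<in> carrier R" for A i using \<Gamma>_closed(1) by blast
  have PR: "A \<in> P i \<Longrightarrow> A \<in> carrier R" for A i using sub \<Gamma>R by blast
  have ex_reps: "\<exists>A. reps A \<phi> \<and> (\<forall>i. A i \<in> Q i)"
    if "\<And>i. Q i \<subseteq> \<Gamma> i" "\<And>i. 0 \<in> Q i" "\<forall>i. \<exists>A\<in>Q i. \<phi> i = gcoset i A" for Q \<phi>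
  proof -
    from that(3) obtain A where A: "\<And>i. A i \<in> Q i \<and> \<phi> i = gcoset i (A i)" by metis
    show ?thesis
      by (rule exI[of _ "\<lambda>i. if \<phi> i = \<Gamma> (i - 1) then 0 else A i"])
        (use A that(1,2) \<Gamma>_closed(2) in \<open>auto simp: reps_def gcoset_0\<close>)
  qed
  have "additive_subgroup (gr_part P) gr"
  proof (rule additive_subgroupI_neg[where neg = "\<lambda>\<phi> i. uminus ` \<phi> i"])
    show "gr_part P \<subseteq> carrier gr" by (auto simp: gr_part_def)
    have "\<Gamma> (i - 1) = gcoset i 0" for i by (simp add: gcoset_0)
    then show "\<zero>\<^bsub>gr\<^esub> \<in> gr_part P"
      using P0 sub by (fastforce simp: gr_part_def carrier_gr gr_simps)
  next
    fix \<phi> \<psi> assume \<phi>: "\<phi> \<in> gr_part P" and \<psi>: "\<psi> \<in> gr_part P"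
    have ex: "\<exists>A\<in>P i. (\<phi> \<oplus>\<^bsub>gr\<^esub> \<psi>) i = gcoset i A" for i
    proof -
      obtain A B where "A \<in> P i" "B \<in> P i" "\<phi> i = gcoset i A" "\<psi> i = gcoset i B"
        using \<phi> \<psi> unfolding gr_part_def by blast
      then show ?thesis using Padd PR by (intro bexI[of _ "A + B"]) (auto simp: gr_simps gcoset_add)
    qed
    have "{i. (\<phi> \<oplus>\<^bsub>gr\<^esub> \<psi>) i \<noteq> \<Gamma> (i - 1)} \<subseteq> {i. \<phi> i \<noteq> \<Gamma> (i - 1)} \<union> {i. \<psi> i \<noteq> \<Gamma> (i - 1)}"
      using gcoset_add[OF example_ring_01(1) example_ring_01(1)] by (auto simp: gr_simps gcoset_0)
    then have "finite {i. (\<phi> \<oplus>\<^bsub>gr\<^esub> \<psi>) i \<noteq> \<Gamma> (i - 1)}"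
      by (rule finite_subset) (use \<phi> \<psi> in \<open>auto simp: gr_part_def carrier_gr\<close>)
    then show "\<phi> \<oplus>\<^bsub>gr\<^esub> \<psi> \<in> gr_part P" using ex sub unfolding gr_part_def carrier_gr by blast
  next
    have neg: "uminus ` gcoset i A = gcoset i (- A)" for i A
    proof -
      have "C \<in> gcoset i A \<longleftrightarrow> - C \<in> gcoset i (- A)" for C
        using \<Gamma>_closed(4)[of "C - A"] \<Gamma>_closed(4)[of "A - C"] by (auto simp: gcoset_iff algebra_simps)
      then show ?thesis by (auto simp: image_iff) (metis minus_minus)
    qed
    fix \<phi> assume \<phi>: "\<phi> \<in> gr_part P"
    have ex: "\<exists>A\<in>P i. uminus ` \<phi> i = gcoset i A" for i
    proof -
      obtain A where "A \<in> P i" "\<phi> i = gcoset i A" using \<phi> unfolding gr_part_def by blast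
      then show ?thesis using Pneg neg by (intro bexI[of _ "- A"]) auto
    qed
    have "{i. uminus ` \<phi> i \<noteq> \<Gamma> (i - 1)} \<subseteq> {i. \<phi> i \<noteq> \<Gamma> (i - 1)}"
      using neg[of _ 0] by (auto simp: gcoset_0)
    then have "finite {i. uminus ` \<phi> i \<noteq> \<Gamma> (i - 1)}"
      by (rule finite_subset) (use \<phi> in \<open>auto simp: gr_part_def carrier_gr\<close>)
    then show "(\<lambda>i. uminus ` \<phi> i) \<in> gr_part P" using ex sub unfolding gr_part_def carrier_gr by blast
    fix \<psi> assume \<psi>: "\<psi> \<in> carrier gr"
    have pt: "\<phi> i <+>\<^bsub>R\<^esub> \<psi> i = \<Gamma> (i - 1) \<and> \<psi> i <+>\<^bsub>R\<^esub> \<phi> i = \<Gamma> (i - 1) \<longleftrightarrow> \<psi> i = uminus ` \<phi> i" for i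
    proof -
      obtain A B where AB: "A \<in> P i" "B \<in> \<Gamma> i" "\<phi> i = gcoset i A" "\<psi> i = gcoset i B"
        using \<phi> \<psi> unfolding gr_part_def carrier_gr by blast
      then have R: "A \<in> carrier R" "B \<in> carrier R" using PR \<Gamma>R by auto
      have "gcoset i (A + B) = \<Gamma> (i - 1) \<longleftrightarrow> gcoset i B = gcoset i (- A)"
        using gcoset_eq_iff[of i "A + B" 0] gcoset_eq_iff[of i B "- A"] by (simp add: gcoset_0 add.commute)
      then show ?thesis using R by (simp add: AB(3,4) gcoset_add neg add.commute)
    qed
    show "\<phi> \<oplus>\<^bsub>gr\<^esub> \<psi> = \<zero>\<^bsub>gr\<^esub> \<and> \<psi> \<oplus>\<^bsub>gr\<^esub> \<phi> = \<zero>\<^bsub>gr\<^esub> \<longleftrightarrow> \<psi> = (\<lambda>i. uminus ` \<phi> i)"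
      using pt unfolding gr_simps fun_eq_iff by blast
  qed
  moreover have "\<phi> \<otimes>\<^bsub>gr\<^esub> \<psi> \<in> gr_part P" if \<phi>: "\<phi> \<in> gr_part P" and \<psi>: "\<psi> \<in> carrier gr" for \<phi> \<psi>
  proof -
    obtain A where A: "reps A \<phi>" "\<And>i. A i \<in> P i"
      using ex_reps[of P \<phi>] sub P0 \<phi> by (auto simp: gr_part_def)
    obtain B where B: "reps B \<psi>"
      using ex_reps[of \<Gamma> \<psi>] \<Gamma>_closed(2) \<psi> by (auto simp: carrier_gr)
    define S where "S = {i. \<phi> i \<noteq> \<Gamma> (i - 1)}"
    define T where "T = {i. \<psi> i \<noteq> \<Gamma> (i - 1)}"
    have fin: "finite S" "finite T" using \<phi> \<psi> by (auto simp: S_def T_def gr_part_def carrier_gr)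
    have val: "(\<phi> \<otimes>\<^bsub>gr\<^esub> \<psi>) n = gcoset n (\<Sum>i\<in>S. A i ** B (n - i))" for n
      using gr_mult[OF A(1) B] fin(1) by (simp add: S_def)
    have "A i ** B (n - i) \<in> P n" for i n
      using Pmult[OF A(2)[of i], of "B (n - i)" "n - i"] B by (simp add: reps_def)
    then have mem: "(\<Sum>i\<in>S. A i ** B (n - i)) \<in> P n" for n
      by (intro sum_closed P0 Padd)
    have "(\<phi> \<otimes>\<^bsub>gr\<^esub> \<psi>) n = \<Gamma> (n - 1)" if n: "n \<notin> (\<lambda>(i, j). i + j) ` (S \<times> T)" for n
    proof -
      have "B (n - i) = 0" if "i \<in> S" for i
      proof -
        have "n - i \<notin> T"
        proof
          assume "n - i \<in> T"
          then have "(\<lambda>(i, j). i + j) (i, n - i) \<in> (\<lambda>(i, j). i + j) ` (S \<times> T)" using that by blast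
          then show False using n by simp
        qed
        then have "\<psi> (n - i) = \<Gamma> (n - i - 1)" by (simp add: T_def)
        then show ?thesis using B unfolding reps_def by blast
      qed
      then show ?thesis by (simp add: val gcoset_0)
    qed
    then have "{n. (\<phi> \<otimes>\<^bsub>gr\<^esub> \<psi>) n \<noteq> \<Gamma> (n - 1)} \<subseteq> (\<lambda>(i, j). i + j) ` (S \<times> T)" by blast
    then have "finite {n. (\<phi> \<otimes>\<^bsub>gr\<^esub> \<psi>) n \<noteq> \<Gamma> (n - 1)}"
      by (rule finite_subset) (use fin in auto)
    then show ?thesis using val mem sub unfolding gr_part_def carrier_gr by blast
  qed
  ultimately show ?thesis by (auto simp: right_ideal_def gr_part_def)
qed

section \<open>Orders along the filtration\<close>

definition ord_f :: "int \<Rightarrow> nat" where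
  "ord_f i = (LEAST j. \<exists>A\<in>\<Gamma> i. fps_nth (res_f A) j \<noteq> 0)"

definition ord_g :: "int \<Rightarrow> nat" where
  "ord_g i = (LEAST j. \<exists>A\<in>\<Gamma> i. res_f A = 0 \<and> fps_nth (res_g A) j \<noteq> 0)"

lemma ord_f_ord_ge: "A \<in> \<Gamma> i \<Longrightarrow> ord_ge (ord_f i) (res_f A)"
  unfolding ord_ge_def ord_f_def using not_less_Least by blast

lemma ord_g_ord_ge: "A \<in> \<Gamma> i \<Longrightarrow> res_f A = 0 \<Longrightarrow> ord_ge (ord_g i) (res_g A)"
  unfolding ord_ge_def ord_g_def using not_less_Least by blast

lemma ord_f_attained: "\<exists>A\<in>\<Gamma> i. fps_nth (res_f A) (ord_f i) \<noteq> 0"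
proof -
  have "fps_nth (fps_nth xS 0) 0 = 0" by simp
  then obtain n where n: "tau (xS ^ n) \<in> \<Gamma> i" using tau_power_in_\<Gamma> by blast
  have "fps_nth (res_f (tau (xS ^ n) :: 'k mat2)) n \<noteq> 0" by (simp add: res_f_tau)
  with n have "\<exists>j. \<exists>A\<in>\<Gamma> i. fps_nth (res_f A) j \<noteq> 0" by blast
  then show ?thesis unfolding ord_f_def by (rule LeastI_ex)
qed

text \<open>Multiplying on the right by \<open>E\<^sub>1\<^sub>2\<close> moves \<open>f\<close> to the position of \<open>g\<close> without leaving the step, since
  the steps are ideals. This bounds \<open>ord_g\<close> by \<open>ord_f\<close>.\<close>

lemma E12_shift:
  "\<exists>A\<in>\<Gamma> i. res_f A = 0 \<and> fps_nth (res_g A) (ord_f i) \<noteq> 0"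
proof -
  obtain A where A: "A \<in> \<Gamma> i" "fps_nth (res_f A) (ord_f i) \<noteq> 0" using ord_f_attained by blast
  have "A ** E12 \<in> \<Gamma> i" using A(1) E12_simps(1) by (rule \<Gamma>_mult_carrier)
  then show ?thesis using A(2) by (intro bexI[of _ "A ** E12"]) (simp_all add: res_mult_E12)
qed

lemma ord_g_attained: "\<exists>A\<in>\<Gamma> i. res_f A = 0 \<and> fps_nth (res_g A) (ord_g i) \<noteq> 0"
  unfolding ord_g_def by (rule LeastI_ex) (use E12_shift[of i] in blast)

lemma ord_g_le_ord_f: "ord_g i \<le> ord_f i"
  unfolding ord_g_def by (rule Least_le) (use E12_shift[of i] in blast)

lemma ord_f_add: "ord_f (i + j) \<le> ord_f i + ord_f j"
proof -
  obtain A B where A: "A \<in> \<Gamma> i" "fps_nth (res_f A) (ord_f i) \<noteq> 0" and B: "B \<in> \<Gamma> j" "fps_nth (res_f B) (ord_f j) \<noteq> 0"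
    using ord_f_attained by metis
  have "res_f (A ** B) = res_f A * res_f B" using B(1) \<Gamma>_closed(1) by (auto intro: res_f_mult)
  then have "fps_nth (res_f (A ** B)) (ord_f i + ord_f j) \<noteq> 0"
    using ord_ge_mult_nth(1)[OF ord_f_ord_ge[OF A(1)] ord_f_ord_ge[OF B(1)]] A(2) B(2) by simp
  then show ?thesis using \<Gamma>_mult[OF A(1) B(1)] unfolding ord_f_def[of "i + j"] by (intro Least_le) blast
qed

lemma ord_f_antimono: "i \<le> j \<Longrightarrow> ord_f j \<le> ord_f i"
  using ord_f_attained[of i] \<Gamma>_mono[of i j] unfolding ord_f_def[of j] by (intro Least_le) blast

lemma ord_g_antimono: "i \<le> j \<Longrightarrow> ord_g j \<le> ord_g i"
  using ord_g_attained[of i] \<Gamma>_mono[of i j] unfolding ord_g_def[of j] by (intro Least_le) blast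

lemma ord_f_nonneg: "i \<ge> 0 \<Longrightarrow> ord_f i = 0"
proof -
  assume "i \<ge> 0"
  then have "mat 1 \<in> \<Gamma> i" using example_ring_01(2) by (simp add: \<Gamma>_nonneg)
  then have "ord_f i \<le> 0" unfolding ord_f_def by (intro Least_le) (auto simp: res_f_simps(5) intro!: bexI[of _ "mat 1"])
  then show ?thesis by simp
qed

lemma ord_f_unbounded: "\<exists>i. ord_f i \<ge> N"
proof -
  obtain i where i: "\<Gamma> i \<subseteq> W (2 * int N)" using \<Gamma>_subset_W by blast
  obtain A where A: "A \<in> \<Gamma> i" "fps_nth (res_f A) (ord_f i) \<noteq> 0" using ord_f_attained by blast
  have "ord_f i \<ge> N"
  proof (rule ccontr)
    assume "\<not> N \<le> ord_f i"
    then have "coef A 1 1 (ord_f i) 0 = 0" using A(1) i by (intro WD[of A "2 * int N"]) (auto simp: wt_def)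
    then show False using A(2) by (simp add: coef_def res_f_def)
  qed
  then show ?thesis by blast
qed

lemma ord_g_unbounded: "\<exists>i. ord_g i \<ge> N"
proof -
  obtain i where i: "\<Gamma> i \<subseteq> W (2 * int N)" using \<Gamma>_subset_W by blast
  obtain A where A: "A \<in> \<Gamma> i" "fps_nth (res_g A) (ord_g i) \<noteq> 0" using ord_g_attained by blast
  have "ord_g i \<ge> N"
  proof (rule ccontr)
    assume "\<not> N \<le> ord_g i"
    then have "coef A 1 2 (ord_g i) 0 = 0" using A(1) i by (intro WD[of A "2 * int N"]) (auto simp: wt_def)
    then show False using A(2) by (simp add: coef_def res_g_def)
  qed
  then show ?thesis by blast
qed

definition jump :: "int \<Rightarrow> bool" where
  "jump i \<longleftrightarrow> ord_g i < ord_g (i - 1)"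

lemma jumps_unbounded: "\<exists>i\<le>i1. jump i"
proof (rule ccontr)
  assume no: "\<not> (\<exists>i\<le>i1. jump i)"
  have "ord_g (i1 - int n) \<le> ord_g i1" for n
  proof (induction n)
    case (Suc n)
    have "\<not> jump (i1 - int n)" using no by simp
    then have "ord_g (i1 - int n - 1) \<le> ord_g (i1 - int n)" by (simp add: jump_def)
    moreover have "i1 - int n - 1 = i1 - int (Suc n)" by simp
    ultimately show ?case using Suc by simp
  qed simp
  moreover obtain i where i: "ord_g i \<ge> Suc (ord_g i1)" using ord_g_unbounded by blast
  moreover have "i1 - int (nat (i1 - i)) \<le> i" by simp
  ultimately show False using ord_g_antimono by (metis Suc_n_not_le_n order_trans)
qed

text \<open>The symbols of the elements with \<open>f = 0\<close> form a right ideal of the associated graded ring. If it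
  is generated in degrees at least \<open>- D\<close>, every symbol of degree \<open>i\<close> in it has a representative for
  which the order of \<open>g\<close> is at least \<open>2 ord_f (i + D)\<close>. At a jump of \<open>ord_g\<close>, changing the
  representative does not affect the coefficient of \<open>g\<close> at \<open>ord_g i\<close>, so that the bound applies to
  \<open>ord_g i\<close> itself.\<close>

lemma right_noetherian_growth:
  assumes noeth: "right_noetherian gr"
  shows "\<exists>D. \<forall>i. jump i \<longrightarrow> 2 * ord_f (i + D) \<le> ord_g i"
proof -
  define N where "N i = {A \<in> \<Gamma> i. res_f A = 0}" for i
  define P where "P D i = {A \<in> \<Gamma> i. res_f A = 0 \<and> ord_ge (2 * ord_f (i + D)) (res_g A)}" for D i
  have rN: "right_ideal (gr_part N) gr"
  proof (rule right_ideal_gr_part)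
    fix i j A B assume "A \<in> N i" "B \<in> \<Gamma> j"
    then show "A ** B \<in> N (i + j)"
      using \<Gamma>_mult[of A i B j] res_f_mult[OF subsetD[OF \<Gamma>_closed(1)], of B j A] by (simp add: N_def)
  qed (use \<Gamma>_closed in \<open>auto simp: N_def res_f_simps\<close>)
  have rP: "right_ideal (gr_part (P D)) gr" for D
  proof (rule right_ideal_gr_part)
    fix i j A B assume A: "A \<in> P D i" and B: "B \<in> \<Gamma> j"
    have "res_f (A ** B) = 0" "ord_ge (2 * (ord_f (i + D) + ord_f j)) (res_g (A ** B))"
      using res_mult_growth[of A "ord_f (i + D)" B "ord_f j"] A B \<Gamma>_closed(1)[of j] ord_f_ord_ge[OF B]
      by (auto simp: P_def)
    moreover have "ord_f (i + j + D) \<le> ord_f (i + D) + ord_f j" using ord_f_add[of "i + D" j] by (simp add: algebra_simps)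
    ultimately show "A ** B \<in> P D (i + j)"
      using \<Gamma>_mult[of A i B j] A B by (auto simp: P_def intro: ord_ge_mono)
  qed (use \<Gamma>_closed in \<open>auto simp: P_def res_f_simps res_g_simps ord_ge_simps\<close>)
  obtain G where G: "G \<subseteq> carrier gr" "finite G"
    and gen: "gr_part N = \<Inter>{J. right_ideal J gr \<and> G \<subseteq> J}"
    using noeth[unfolded right_noetherian_def, rule_format, OF rN] by blast
  have "finite (\<Union>\<phi>\<in>G. {i. \<phi> i \<noteq> \<Gamma> (i - 1)})" using G by (auto simp: carrier_gr)
  then obtain D where D: "\<And>\<phi> i. \<phi> \<in> G \<Longrightarrow> \<phi> i \<noteq> \<Gamma> (i - 1) \<Longrightarrow> - D \<le> i"
  proof -
    assume fin: "finite (\<Union>\<phi>\<in>G. {i. \<phi> i \<noteq> \<Gamma> (i - 1)})"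
    obtain m where "\<forall>i\<in>(\<Union>\<phi>\<in>G. {i. \<phi> i \<noteq> \<Gamma> (i - 1)}). m \<le> i"
      using bdd_below_finite[OF fin] unfolding bdd_below_def by blast
    then show ?thesis using that[of "- m"] by auto
  qed
  have "G \<subseteq> gr_part N" unfolding gen by blast
  have "G \<subseteq> gr_part (P D)"
  proof
    fix \<phi> assume \<phi>: "\<phi> \<in> G"
    have "\<exists>A\<in>P D i. \<phi> i = gcoset i A" for i
    proof (cases "- D \<le> i")
      case True
      obtain A where "A \<in> N i" "\<phi> i = gcoset i A" using \<phi> \<open>G \<subseteq> gr_part N\<close> unfolding gr_part_def by blast
      then show ?thesis using True ord_f_nonneg[of "i + D"]
        by (intro bexI[of _ A]) (auto simp: N_def P_def ord_ge_simps)
    next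
      case False
      then have "\<phi> i = \<Gamma> (i - 1)" using D \<phi> by blast
      then show ?thesis using \<Gamma>_closed(2)
        by (intro bexI[of _ 0]) (auto simp: gcoset_0 P_def res_f_simps res_g_simps ord_ge_simps)
    qed
    then show "\<phi> \<in> gr_part (P D)" using \<phi> G(1) by (auto simp: gr_part_def)
  qed
  then have le: "gr_part N \<subseteq> gr_part (P D)" unfolding gen using rP by blast
  have "2 * ord_f (i + D) \<le> ord_g i" if jump: "jump i" for i
  proof -
    obtain A where A: "A \<in> \<Gamma> i" "res_f A = 0" "fps_nth (res_g A) (ord_g i) \<noteq> 0" using ord_g_attained by blast
    define \<phi> where "\<phi> j = (if j = i then gcoset i A else \<Gamma> (j - 1))" for j
    have "\<exists>B\<in>N j. \<phi> j = gcoset j B" for j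
    proof (cases "j = i")
      case True
      then show ?thesis using A(1,2) by (intro bexI[of _ A]) (simp_all add: \<phi>_def N_def)
    next
      case False
      then show ?thesis using \<Gamma>_closed(2)
        by (intro bexI[of _ 0]) (simp_all add: \<phi>_def N_def gcoset_0 res_f_simps)
    qed
    moreover have "finite {j. \<phi> j \<noteq> \<Gamma> (j - 1)}" by (rule finite_subset[of _ "{i}"]) (auto simp: \<phi>_def)
    moreover have "N j \<subseteq> \<Gamma> j" for j by (auto simp: N_def)
    ultimately have "\<phi> \<in> gr_part N" unfolding gr_part_def carrier_gr by blast
    then obtain B where B: "B \<in> P D i" "\<phi> i = gcoset i B" using le unfolding gr_part_def by blast
    then have "A - B \<in> \<Gamma> (i - 1)" by (simp add: \<phi>_def gcoset_eq_iff)
    moreover have "res_f (A - B) = 0" using A(2) B(1) by (simp add: P_def res_f_simps)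
    ultimately have "ord_ge (ord_g (i - 1)) (res_g (A - B))" by (rule ord_g_ord_ge)
    then have "fps_nth (res_g (A - B)) (ord_g i) = 0" using jump by (simp add: ord_ge_def jump_def)
    then have "fps_nth (res_g B) (ord_g i) \<noteq> 0" using A(3) by (simp add: res_g_simps)
    moreover have "ord_ge (2 * ord_f (i + D)) (res_g B)" using B(1) by (simp add: P_def)
    ultimately show ?thesis unfolding ord_ge_def by (meson not_le)
  qed
  then show ?thesis by blast
qed

text \<open>At a jump, \<open>2 ord_f (i + D) \<le> ord_g i \<le> ord_f i \<le> ord_f (i + D) + ord_f (- D)\<close>. So \<open>ord_f (i + D)\<close>
  would stay bounded over the jumps, which occur at arbitrarily small \<open>i\<close>.\<close>

theorem not_right_noetherian_gr: "\<not> right_noetherian gr"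
proof
  assume "right_noetherian gr"
  then obtain D where D: "\<And>i. jump i \<Longrightarrow> 2 * ord_f (i + D) \<le> ord_g i" using right_noetherian_growth by blast
  obtain i0 where i0: "ord_f i0 \<ge> Suc (ord_f (- D))" using ord_f_unbounded by blast
  obtain i where i: "i \<le> i0 - D" "jump i" using jumps_unbounded by blast
  have "2 * ord_f (i + D) \<le> ord_f (i + D) + ord_f (- D)"
    using D[OF i(2)] ord_g_le_ord_f[of i] ord_f_add[of "i + D" "- D"] by simp
  moreover have "ord_f i0 \<le> ord_f (i + D)" using i(1) by (intro ord_f_antimono) simp
  ultimately show False using i0 by simp
qed

end

theorem mainTheorem6:
  fixes K :: "'k::field ring"
    and R :: "('k, 'k fps fps ^ 2 ^ 2) module"
  assumes "K = ring_of_type_algebra"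
    and "R = example_ring"
  shows "k_algebra K R \<and> prime_ring R \<and> noetherian R \<and> complete_ring R \<and> local_ring R \<and>
      PI_algebra K R \<and>
      \<not> (\<exists>\<Gamma>. weak_adic_filtration K R \<Gamma> \<and> right_noetherian (assoc_graded R \<Gamma>)) \<and>
      \<not> strong_AR R (jacobson_radical R)"
proof -
  have "\<not> (\<exists>\<Gamma>. weak_adic_filtration K R \<Gamma> \<and> right_noetherian (assoc_graded R \<Gamma>))"
    using weak_adic.not_right_noetherian_gr unfolding weak_adic_def assms by blast
  then show ?thesis
    using k_algebra_example_ring prime_ring_example_ring noetherian_example_ring complete_example_ring
      local_ring_example_ring PI_algebra_example_ring not_strong_AR_example_ring
    unfolding assms by blast
qed

end
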